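(* Let $\alpha>0$, let $\nu\in\mathcal{P}_+$, and let $R(t)=\mathbf{E}N(t)$ be the renewal function of the renewal process for the Kendall convolution $\vartriangle_\alpha$ with unit step distribution $\nu$. Suppose that the cumulative distribution function $F$ of $\nu$ is differentiable with density $f=F'$ and that $\lim_{t\to\infty}tH'(t)/H(t)=\theta$, where $0\le\theta<\alpha$. Then (i) $\displaystyle\lim_{t\to\infty}\frac{H(t)R'(t)}{t^{\alpha-1}}=\Bigl(\frac{\alpha-\theta}{\alpha}\Bigr)^2(2\alpha-\theta)=:c$; (ii) for all $h>0$, $\displaystyle\lim_{t\to\infty}\frac{H(t)\,(R(t+h)-R(t))}{t^{\alpha-1}}=ch$.
   Context: $\mathcal{P}_+$ is the set of Borel probability measures on $[0,\infty)$. For $\alpha>0$ the Kendall convolution $\vartriangle_\alpha$ is the commutative, associative operation on $\mathcal{P}_+$ given by $\delta_x\vartriangle_\alpha\delta_1=(1-x^\alpha)\delta_1+x^\alpha\pi_{2\alpha}$ for $x\in[0,1]$, where $\pi_{2\alpha}(dy)=2\alpha y^{-2\alpha-1}\mathbf{1}_{[1,\infty)}(y)\,dy$; by scaling, for $0\le x\le y$, $y>0$, $\delta_x\vartriangle_\alpha\delta_y$ is the law of $yX$ where $X$ has law $\delta_{x/y}\vartriangle_\alpha\delta_1$; $\delta_0\vartriangle_\alpha\delta_0=\delta_0$; and $(\lambda_1\vartriangle_\alpha\lambda_2)(A)=\int\int(\delta_x\vartriangle_\alpha\delta_y)(A)\,\lambda_1(dx)\lambda_2(dy)$. $\nu^{\vartriangle_\alpha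 n}$ is the $n$-fold convolution power. The Kendall random walk with step distribution $\nu$ is the Markov process $(S_n)_{n\ge1}$ with $\mathcal{L}(S_1)=\nu$ and $P(S_n\in\cdot\mid S_k=x)=\delta_x\vartriangle_\alpha\nu^{\vartriangle_\alpha(n-k)}$ for $k<n$. The renewal process is $N(t)=\inf\{n\ge0:S_{n+1}>t\}$ ($=\infty$ if no such $n$ exists). $F(t)=\nu([0,t])$; differentiability of $F$ is meant on $(0,\infty)$, and $f$ is the Lebesgue density of $\nu$. $H(t)=\int_0^t x^\alpha\,\nu(dx)=\int_0^t x^\alpha f(x)\,dx$, so $H'(t)=t^\alpha f(t)$. *)

theory Defs
  imports "HOL-Probability.Probability"
begin

(* The class P_+: a law on [0,\<infinity>) is represented as a Borel measure on the real line
   that does not charge the negative half-line. *)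
definition P_plus :: "real measure set" where
  "P_plus = {\<nu>. real_distribution \<nu> \<and> (AE x in \<nu>. 0 \<le> x)}"

definition pareto :: "real \<Rightarrow> real measure" where
  "pareto \<beta> = density lborel (\<lambda>y. ennreal (\<beta> * y powr (- \<beta> - 1)) * indicator {1..} y)"

definition kendall_unit :: "real \<Rightarrow> real \<Rightarrow> real measure" where
  "kendall_unit \<alpha> x = measure_of UNIV (sets borel)
     (\<lambda>A. ennreal (1 - x powr \<alpha>) * emeasure (return borel 1) A
        + ennreal (x powr \<alpha>) * emeasure (pareto (2 * \<alpha>)) A)"

(* Only arguments x, y \<ge> 0 are meaningful.  The default branch contains the case x = y = 0;
   for negative arguments its value is irrelevant, but it keeps the kernel measurable on the
   whole line, so that the monadic bind below is well-behaved. *)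
definition kendall_dirac :: "real \<Rightarrow> real \<Rightarrow> real \<Rightarrow> real measure" where
  "kendall_dirac \<alpha> x y =
     (if 0 \<le> min x y \<and> 0 < max x y
      then distr (kendall_unit \<alpha> (min x y / max x y)) borel (\<lambda>z. max x y * z)
      else return borel 0)"

(* See emeasure_kendall_conv below for the explicit double integral. *)
definition kendall_conv :: "real \<Rightarrow> real measure \<Rightarrow> real measure \<Rightarrow> real measure" where
  "kendall_conv \<alpha> \<mu> \<nu> = \<mu> \<bind> (\<lambda>x. \<nu> \<bind> (\<lambda>y. kendall_dirac \<alpha> x y))"

(* The Dirac measure at 0 is the neutral element. *)
primrec kendall_power :: "real \<Rightarrow> real measure \<Rightarrow> nat \<Rightarrow> real measure" where
  "kendall_power \<alpha> \<nu> 0 = return borel 0"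
| "kendall_power \<alpha> \<nu> (Suc n) = kendall_conv \<alpha> (kendall_power \<alpha> \<nu> n) \<nu>"

lemma prob_space_pareto:
  assumes "0 < \<beta>"
  shows "prob_space (pareto \<beta>)"
proof
  have "((\<lambda>y::real. y powr (- \<beta>)) \<longlongrightarrow> 0) at_top"
    using assms by (intro tendsto_neg_powr filterlim_ident) auto
  then have lim: "((\<lambda>y::real. - (y powr (- \<beta>))) \<longlongrightarrow> 0) at_top"
    using tendsto_minus by fastforce
  have "(\<integral>\<^sup>+y. ennreal (\<beta> * y powr (- \<beta> - 1)) * indicator {1..} y \<partial>lborel)
      = ennreal (0 - (- (1 powr (- \<beta>))))"
    using assms
    by (intro nn_integral_FTC_atLeast[OF _ _ _ lim])
      (auto intro!: derivative_eq_intros simp: powr_diff field_simps)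
  then show "emeasure (pareto \<beta>) (space (pareto \<beta>)) = 1"
    by (simp add: pareto_def emeasure_density)
qed

lemma sets_kendall_unit [simp, measurable_cong]: "sets (kendall_unit \<alpha> x) = sets borel"
  unfolding kendall_unit_def using sigma_algebra.sets_measure_of_eq[of UNIV "sets borel"]
  by (metis sets.sigma_algebra_axioms space_borel)

lemma space_kendall_unit [simp]: "space (kendall_unit \<alpha> x) = UNIV"
  using sets_eq_imp_space_eq[OF sets_kendall_unit] by simp

lemma emeasure_kendall_unit:
  assumes "A \<in> sets borel"
  shows "emeasure (kendall_unit \<alpha> x) A =
    ennreal (1 - x powr \<alpha>) * emeasure (return borel 1) A
      + ennreal (x powr \<alpha>) * emeasure (pareto (2 * \<alpha>)) A"
  unfolding kendall_unit_def
proof (rule emeasure_measure_of_sigma)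
  show "sigma_algebra UNIV (sets (borel :: real measure))"
    by (metis sets.sigma_algebra_axioms space_borel)
  have p: "sets (pareto (2 * \<alpha>)) = sets borel" by (simp add: pareto_def)
  show "countably_additive (sets borel)
     (\<lambda>A. ennreal (1 - x powr \<alpha>) * emeasure (return borel 1) A
        + ennreal (x powr \<alpha>) * emeasure (pareto (2 * \<alpha>)) A)"
    unfolding countably_additive_def
  proof (intro allI impI)
    fix A :: "nat \<Rightarrow> real set"
    assume A: "range A \<subseteq> sets borel" "disjoint_family A"
    show "(\<Sum>i. ennreal (1 - x powr \<alpha>) * emeasure (return borel 1) (A i)
        + ennreal (x powr \<alpha>) * emeasure (pareto (2 * \<alpha>)) (A i))
      = ennreal (1 - x powr \<alpha>) * emeasure (return borel 1) (\<Union> (range A))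
        + ennreal (x powr \<alpha>) * emeasure (pareto (2 * \<alpha>)) (\<Union> (range A))"
      using A p
      by (simp add: suminf_add[symmetric] suminf_emeasure ennreal_suminf_cmult
          del: emeasure_return)
  qed
qed (auto simp: positive_def assms)

lemma prob_space_kendall_unit:
  assumes "0 < \<alpha>" "0 \<le> x" "x \<le> 1"
  shows "prob_space (kendall_unit \<alpha> x)"
proof
  interpret P: prob_space "pareto (2 * \<alpha>)" using assms by (intro prob_space_pareto) simp
  have "x powr \<alpha> \<le> 1" using assms by (simp add: powr_le1)
  moreover have "emeasure (pareto (2 * \<alpha>)) UNIV = 1"
    using P.emeasure_space_1 by (simp add: pareto_def)
  ultimately show "emeasure (kendall_unit \<alpha> x) (space (kendall_unit \<alpha> x)) = 1"
    by (simp add: emeasure_kendall_unit flip: ennreal_plus)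
qed

lemma sets_kendall_dirac [simp, measurable_cong]: "sets (kendall_dirac \<alpha> x y) = sets borel"
  by (simp add: kendall_dirac_def)

lemma prob_space_kendall_dirac:
  assumes "0 < \<alpha>"
  shows "prob_space (kendall_dirac \<alpha> x y)"
proof (cases "0 \<le> min x y \<and> 0 < max x y")
  case True
  then have "prob_space (kendall_unit \<alpha> (min x y / max x y))"
    using assms by (intro prob_space_kendall_unit) (auto simp: field_simps)
  then show ?thesis
    using True by (simp add: kendall_dirac_def prob_space.prob_space_distr)
next
  case False
  then show ?thesis by (auto simp: kendall_dirac_def intro!: prob_space_return)
qed

lemma measurable_kendall_dirac:
  assumes "0 < \<alpha>"
  shows "(\<lambda>w. kendall_dirac \<alpha> (fst w) (snd w)) \<in> borel \<Otimes>\<^sub>M borel \<rightarrow>\<^sub>M subprob_algebra borel"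
proof (rule measurable_subprob_algebra)
  fix A :: "real set" assume A [measurable]: "A \<in> sets borel"
  interpret P: prob_space "pareto (2 * \<alpha>)" using assms by (intro prob_space_pareto) simp
  have [measurable_cong]: "sets (pareto (2 * \<alpha>)) = sets borel" by (simp add: pareto_def)
  have *: "emeasure (kendall_dirac \<alpha> x y) A =
    (if 0 \<le> min x y \<and> 0 < max x y
     then ennreal (1 - (min x y / max x y) powr \<alpha>) * indicator A (max x y * 1)
        + ennreal ((min x y / max x y) powr \<alpha>) *
            (\<integral>\<^sup>+z. indicator A (max x y * z) \<partial>pareto (2 * \<alpha>))
     else indicator A 0)" for x y :: real
  proof -
    define m where "m = max x y"
    have B: "(\<lambda>z. m * z) -` A \<in> sets borel"
      using measurable_sets_borel[of "\<lambda>z. m * z" borel A] by simp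
    have "(\<integral>\<^sup>+z. indicator A (m * z) \<partial>pareto (2 * \<alpha>))
        = (\<integral>\<^sup>+z. indicator ((\<lambda>z. m * z) -` A) z \<partial>pareto (2 * \<alpha>))"
      by (intro nn_integral_cong) (auto simp: indicator_def)
    also have "\<dots> = emeasure (pareto (2 * \<alpha>)) ((\<lambda>z. m * z) -` A)"
      using B by (simp add: pareto_def)
    finally have "(\<integral>\<^sup>+z. indicator A (m * z) \<partial>pareto (2 * \<alpha>))
        = emeasure (pareto (2 * \<alpha>)) ((\<lambda>z. m * z) -` A)" .
    moreover have "indicator ((\<lambda>z. m * z) -` A) 1 = (indicator A m :: ennreal)"
      by (auto simp: indicator_def)
    ultimately show ?thesis
      using B unfolding kendall_dirac_def m_def[symmetric]
      by (auto simp: emeasure_distr emeasure_kendall_unit)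
  qed
  show "(\<lambda>w. emeasure (kendall_dirac \<alpha> (fst w) (snd w)) A)
      \<in> borel_measurable (borel \<Otimes>\<^sub>M borel)"
    unfolding * by measurable
qed (auto intro: prob_space_imp_subprob_space prob_space_kendall_dirac[OF assms])

lemma measurable_kendall_dirac_bind:
  assumes "0 < \<alpha>" "real_distribution \<nu>"
  shows "(\<lambda>x. \<nu> \<bind> (\<lambda>y. kendall_dirac \<alpha> x y)) \<in> borel \<rightarrow>\<^sub>M subprob_algebra borel"
proof (rule measurable_bind)
  interpret real_distribution \<nu> by fact
  show "(\<lambda>x. \<nu>) \<in> borel \<rightarrow>\<^sub>M subprob_algebra borel"
    by (auto simp: space_subprob_algebra intro!: measurable_const prob_space_imp_subprob_space prob_space_axioms)
qed (rule measurable_kendall_dirac[OF assms(1)])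

lemma emeasure_kendall_conv:
  assumes "0 < \<alpha>" "real_distribution \<mu>" "real_distribution \<nu>" "A \<in> sets borel"
  shows "emeasure (kendall_conv \<alpha> \<mu> \<nu>) A =
    (\<integral>\<^sup>+x. \<integral>\<^sup>+y. emeasure (kendall_dirac \<alpha> x y) A \<partial>\<nu> \<partial>\<mu>)"
proof -
  interpret m: real_distribution \<mu> by fact
  interpret n: real_distribution \<nu> by fact
  have y: "kendall_dirac \<alpha> x \<in> \<nu> \<rightarrow>\<^sub>M subprob_algebra borel" for x
    using measurable_compose[OF measurable_Pair1' measurable_kendall_dirac[OF assms(1)], of x]
    by simp
  have "emeasure (\<nu> \<bind> kendall_dirac \<alpha> x) A = (\<integral>\<^sup>+y. emeasure (kendall_dirac \<alpha> x y) A \<partial>\<nu>)" for x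
    using y assms(4) by (intro emeasure_bind) auto
  moreover have "(\<lambda>x. \<nu> \<bind> kendall_dirac \<alpha> x) \<in> \<mu> \<rightarrow>\<^sub>M subprob_algebra borel"
    using measurable_kendall_dirac_bind[OF assms(1,3)] by simp
  ultimately show ?thesis
    unfolding kendall_conv_def using assms(4) by (subst emeasure_bind) auto
qed

lemma real_distribution_kendall_conv:
  assumes "0 < \<alpha>" "real_distribution \<mu>" "real_distribution \<nu>"
  shows "real_distribution (kendall_conv \<alpha> \<mu> \<nu>)"
proof -
  interpret m: real_distribution \<mu> by fact
  interpret n: real_distribution \<nu> by fact
  have s: "sets (kendall_conv \<alpha> \<mu> \<nu>) = sets borel"
    unfolding kendall_conv_def by (intro sets_bind) (auto intro!: sets_bind)
  have "space (kendall_dirac \<alpha> x y) = UNIV" for x y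
    using sets_eq_imp_space_eq[OF sets_kendall_dirac] by simp
  then have "emeasure (kendall_dirac \<alpha> x y) UNIV = 1" for x y
    using prob_space.emeasure_space_1[OF prob_space_kendall_dirac[OF assms(1)]] by metis
  then have "emeasure (kendall_conv \<alpha> \<mu> \<nu>) UNIV = 1"
    using m.emeasure_space_1 n.emeasure_space_1 by (simp add: emeasure_kendall_conv assms)
  moreover have "space (kendall_conv \<alpha> \<mu> \<nu>) = UNIV"
    using sets_eq_imp_space_eq[OF s] by simp
  ultimately show ?thesis
    using s by (auto simp: real_distribution_def real_distribution_axioms_def intro!: prob_spaceI)
qed

lemma kendall_power_1:
  assumes "0 < \<alpha>" "\<nu> \<in> P_plus"
  shows "kendall_power \<alpha> \<nu> 1 = \<nu>"
proof -
  have rd: "real_distribution \<nu>" and nn: "AE x in \<nu>. 0 \<le> x"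
    using assms by (auto simp: P_plus_def)
  interpret n: real_distribution \<nu> by fact
  have r0: "real_distribution (return borel 0)"
    by (auto simp: real_distribution_def real_distribution_axioms_def intro!: prob_space_return)
  have d: "emeasure (kendall_dirac \<alpha> 0 y) A = indicator A y"
    if "0 \<le> y" "A \<in> sets borel" for y A
  proof (cases "y = 0")
    case False
    have "(\<lambda>z. y * z) -` A \<in> sets borel"
      using measurable_sets_borel[of "\<lambda>z. y * z" borel A] that by simp
    then show ?thesis using False that
      by (auto simp: kendall_dirac_def emeasure_distr emeasure_kendall_unit indicator_def)
  qed (use that in \<open>simp add: kendall_dirac_def\<close>)
  show ?thesis
  proof (rule measure_eqI)
    show "sets (kendall_power \<alpha> \<nu> 1) = sets \<nu>"
      using real_distribution.events_eq_borel[OF real_distribution_kendall_conv[OF assms(1) r0 rd]]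
      by simp
    fix A assume "A \<in> sets (kendall_power \<alpha> \<nu> 1)"
    then have A: "A \<in> sets borel"
      using real_distribution.events_eq_borel[OF real_distribution_kendall_conv[OF assms(1) r0 rd]]
      by simp
    have "(\<lambda>x. \<integral>\<^sup>+y. emeasure (kendall_dirac \<alpha> x y) A \<partial>\<nu>) \<in> borel_measurable borel"
    proof (rule n.borel_measurable_nn_integral)
      have "(\<lambda>w. emeasure (kendall_dirac \<alpha> (fst w) (snd w)) A) \<in> borel_measurable (borel \<Otimes>\<^sub>M borel)"
        using measurable_compose[OF measurable_kendall_dirac[OF assms(1)]
            measurable_emeasure_subprob_algebra[OF A]] .
      then show "(\<lambda>(x, y). emeasure (kendall_dirac \<alpha> x y) A) \<in> borel_measurable (borel \<Otimes>\<^sub>M \<nu>)"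
        by (simp add: case_prod_beta' cong: measurable_cong_sets)
    qed
    then have "emeasure (kendall_power \<alpha> \<nu> 1) A = (\<integral>\<^sup>+y. emeasure (kendall_dirac \<alpha> 0 y) A \<partial>\<nu>)"
      by (simp add: emeasure_kendall_conv[OF assms(1) r0 rd A] nn_integral_return)
    also have "\<dots> = (\<integral>\<^sup>+y. indicator A y \<partial>\<nu>)"
      using nn A by (intro nn_integral_cong_AE) (auto simp: d)
    finally show "emeasure (kendall_power \<alpha> \<nu> 1) A = emeasure \<nu> A"
      using A by simp
  qed
qed

(* Natural filtration of (S n), n \<ge> 1. *)
definition past :: "'a measure \<Rightarrow> (nat \<Rightarrow> 'a \<Rightarrow> real) \<Rightarrow> nat \<Rightarrow> 'a measure" where
  "past M S k = sigma (space M)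
     {S i -` A \<inter> space M | i A. 1 \<le> i \<and> i \<le> k \<and> A \<in> sets borel}"

locale kendall_random_walk = prob_space M
  for M :: "'a measure" and S :: "nat \<Rightarrow> 'a \<Rightarrow> real" and \<alpha> :: real and \<nu> :: "real measure" +
  assumes random_variable: "\<And>n. 1 \<le> n \<Longrightarrow> S n \<in> borel_measurable M"
    and initial: "distr M borel (S 1) = \<nu>"
    and markov: "\<And>k n A. 1 \<le> k \<Longrightarrow> k < n \<Longrightarrow> A \<in> sets borel \<Longrightarrow>
      AE \<omega> in M. real_cond_exp M (past M S k) (\<lambda>\<omega>'. indicator A (S n \<omega>')) \<omega>
        = measure (kendall_conv \<alpha> (return borel (S k \<omega>)) (kendall_power \<alpha> \<nu> (n - k))) A"

definition renewal_process :: "(nat \<Rightarrow> 'a \<Rightarrow> real) \<Rightarrow> real \<Rightarrow> 'a \<Rightarrow> enat" where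
  "renewal_process S t \<omega> = Inf {enat n | n. S (Suc n) \<omega> > t}"

definition renewal_function :: "'a measure \<Rightarrow> (nat \<Rightarrow> 'a \<Rightarrow> real) \<Rightarrow> real \<Rightarrow> ennreal" where
  "renewal_function M S t = (\<integral>\<^sup>+\<omega>. ennreal_of_enat (renewal_process S t \<omega>) \<partial>M)"

definition truncated_moment :: "real \<Rightarrow> real measure \<Rightarrow> real \<Rightarrow> real" where
  "truncated_moment \<alpha> \<nu> t = (LINT x:{0..t}|\<nu>. x powr \<alpha>)"

end

theory Submission
  imports Defs
begin

text \<open>
  The Williamson transform \<open>W t = \<integral> (1 - (x / t)\<^sup>\<alpha>)\<^sub>+ \<nu>(dx)\<close> is multiplicative for the Kendall
  convolution. With \<open>h t = H t / t\<^sup>\<alpha>\<close> one has \<open>F = W + h\<close>, and convolution acts on the pairs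
  \<open>(W, h)\<close> like multiplication of dual numbers \<open>W + h \<epsilon>\<close>, \<open>\<epsilon>\<^sup>2 = 0\<close>, so that
  \<open>P (S n \<le> t) = W\<^sup>n + n W\<^sup>n\<^sup>-\<^sup>1 h\<close>. The walk is almost surely nondecreasing, hence
  \<open>R t = (\<Sum>n\<ge>1. P (S n \<le> t)) = W / (1 - W) + h / (1 - W)\<^sup>2\<close>.
  Put \<open>u = 1 - W\<close>. Then \<open>u' = - \<alpha> h / t\<close> and \<open>h' = f - \<alpha> h / t\<close>, which gives
  \<open>R' = f / u\<^sup>2 + 2 \<alpha> h\<^sup>2 / (t u\<^sup>3)\<close>, and (i) follows from \<open>t f / h \<longlonglongrightarrow> \<theta>\<close> and
  \<open>h / u \<longlonglongrightarrow> (\<alpha> - \<theta>) / \<alpha>\<close>. Part (ii) follows by the mean value theorem.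
\<close>

section \<open>Kernels under the Kendall convolution\<close>

definition moment_kernel :: "real \<Rightarrow> real \<Rightarrow> real \<Rightarrow> real" where
  "moment_kernel \<alpha> t x = (x / t) powr \<alpha> * indicator {0..t} x"

definition williamson_kernel :: "real \<Rightarrow> real \<Rightarrow> real \<Rightarrow> real" where
  "williamson_kernel \<alpha> t x = (1 - (x / t) powr \<alpha>) * indicator {0..t} x"

lemma moment_kernel_measurable [measurable]: "moment_kernel \<alpha> t \<in> borel_measurable borel"
  unfolding moment_kernel_def by measurable

lemma williamson_kernel_measurable [measurable]: "williamson_kernel \<alpha> t \<in> borel_measurable borel"
  unfolding williamson_kernel_def by measurable

lemma moment_kernel_nonneg [simp]: "0 \<le> moment_kernel \<alpha> t x"
  by (simp add: moment_kernel_def)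

lemma powr_ratio_le_one:
  fixes x t \<alpha> :: real
  assumes "0 < \<alpha>" "0 \<le> x" "x \<le> t" "0 < t"
  shows "(x / t) powr \<alpha> \<le> 1"
  using assms by (intro powr_le1) (auto simp: field_simps)

lemma moment_kernel_le_one: "0 < \<alpha> \<Longrightarrow> 0 < t \<Longrightarrow> moment_kernel \<alpha> t x \<le> 1"
  by (auto simp: moment_kernel_def indicator_def powr_ratio_le_one)

lemma williamson_kernel_nonneg: "0 < \<alpha> \<Longrightarrow> 0 < t \<Longrightarrow> 0 \<le> williamson_kernel \<alpha> t x"
  by (auto simp: williamson_kernel_def indicator_def powr_ratio_le_one)

lemma williamson_kernel_le_one: "williamson_kernel \<alpha> t x \<le> 1"
  by (auto simp: williamson_kernel_def indicator_def)

text \<open>Integrated against a law on the half-line, this splits its distribution function into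
  \<open>williamson\<close> and \<open>scaled_moment\<close>.\<close>

lemma williamson_plus_moment_kernel:
  "williamson_kernel \<alpha> t x + moment_kernel \<alpha> t x = indicator {0..t} x"
  by (auto simp: williamson_kernel_def moment_kernel_def indicator_def)

section \<open>Integrals against the Kendall kernel\<close>

lemma nn_integral_kendall_unit:
  assumes "g \<in> borel_measurable borel"
  shows "(\<integral>\<^sup>+z. g z \<partial>kendall_unit \<alpha> x) =
    ennreal (1 - x powr \<alpha>) * g 1 + ennreal (x powr \<alpha>) * (\<integral>\<^sup>+z. g z \<partial>pareto (2 * \<alpha>))"
proof -
  have sp [measurable_cong]: "sets (pareto (2 * \<alpha>)) = sets borel" by (simp add: pareto_def)
  have mu: "f \<in> borel_measurable (kendall_unit \<alpha> x) \<longleftrightarrow> f \<in> borel_measurable borel"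
    "f \<in> borel_measurable (pareto (2 * \<alpha>)) \<longleftrightarrow> f \<in> borel_measurable borel" for f :: "real \<Rightarrow> ennreal"
    by (auto intro!: measurable_cong_sets simp: sp)
  have space_eq: "space (pareto (2 * \<alpha>)) = UNIV" by (simp add: pareto_def)
  from assms show ?thesis
  \<comment> \<open>\<open>kendall_unit\<close> is known only through its values on sets, so the
    formula is built up from indicators by multiples, sums and monotone limits.\<close>
  proof (induction rule: borel_measurable_induct)
    case (cong f g)
    then have "f = g" by (auto simp: fun_eq_iff)
    with cong show ?case by simp
  next
    case (set A)
    then show ?case by (simp add: emeasure_kendall_unit sp)
  next
    case (mult u c)
    then show ?case by (simp add: nn_integral_cmult mu distrib_left mult.left_commute)
  next
    case (add u v)
    then show ?case by (simp add: nn_integral_add mu distrib_left add_ac)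
  next
    case (seq U)
    have inc: "incseq U" by fact
    then have incx: "incseq (\<lambda>i. U i y)" for y by (auto simp: incseq_def le_fun_def)
    have incI: "incseq (\<lambda>i. \<integral>\<^sup>+z. U i z \<partial>pareto (2 * \<alpha>))"
      using inc by (auto simp: incseq_def le_fun_def intro!: nn_integral_mono)
    have "(\<integral>\<^sup>+z. (SUP i. U i) z \<partial>kendall_unit \<alpha> x) = (SUP i. \<integral>\<^sup>+z. U i z \<partial>kendall_unit \<alpha> x)"
      using inc seq(1) by (simp add: image_image nn_integral_monotone_convergence_SUP mu)
    also have "\<dots> = (SUP i. ennreal (1 - x powr \<alpha>) * U i 1
        + ennreal (x powr \<alpha>) * (\<integral>\<^sup>+z. U i z \<partial>pareto (2 * \<alpha>)))"
      using seq by simp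
    also have "\<dots> = (SUP i. ennreal (1 - x powr \<alpha>) * U i 1)
        + (SUP i. ennreal (x powr \<alpha>) * (\<integral>\<^sup>+z. U i z \<partial>pareto (2 * \<alpha>)))"
      using incx[of 1] incI
      by (intro ennreal_SUP_add) (auto simp: incseq_def intro!: mult_left_mono)
    also have "\<dots> = ennreal (1 - x powr \<alpha>) * (SUP i. U i 1)
        + ennreal (x powr \<alpha>) * (SUP i. \<integral>\<^sup>+z. U i z \<partial>pareto (2 * \<alpha>))"
      by (simp add: SUP_mult_left_ennreal)
    also have "(SUP i. \<integral>\<^sup>+z. U i z \<partial>pareto (2 * \<alpha>)) = (\<integral>\<^sup>+z. (SUP i. U i) z \<partial>pareto (2 * \<alpha>))"
      using inc seq(1) by (simp add: image_image nn_integral_monotone_convergence_SUP mu)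
    finally show ?case by (simp add: image_image)
  qed
qed

text \<open>Taking the smaller argument first loses nothing, by
  \<open>kendall_dirac_commute\<close>. The Pareto part is written against Lebesgue measure so that
  the fundamental theorem of calculus can evaluate it.\<close>

lemma nn_integral_kendall_dirac:
  assumes [measurable]: "g \<in> borel_measurable borel" and xy: "0 \<le> x" "x \<le> y" "0 < y"
  shows "(\<integral>\<^sup>+z. g z \<partial>kendall_dirac \<alpha> x y) =
    ennreal (1 - (x / y) powr \<alpha>) * g y
      + ennreal ((x / y) powr \<alpha>)
        * (\<integral>\<^sup>+z. ennreal (2 * \<alpha> * z powr (- (2 * \<alpha>) - 1)) * indicator {1..} z * g (y * z) \<partial>lborel)"
proof -
  have m: "max x y = y" "min x y = x" using xy by auto
  have "(\<integral>\<^sup>+z. g z \<partial>kendall_dirac \<alpha> x y) = (\<integral>\<^sup>+z. g (y * z) \<partial>kendall_unit \<alpha> (x / y))"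
    using xy by (simp add: kendall_dirac_def m nn_integral_distr)
  also have "\<dots> = ennreal (1 - (x / y) powr \<alpha>) * g (y * 1)
      + ennreal ((x / y) powr \<alpha>) * (\<integral>\<^sup>+z. g (y * z) \<partial>pareto (2 * \<alpha>))"
    by (rule nn_integral_kendall_unit) measurable
  also have "(\<integral>\<^sup>+z. g (y * z) \<partial>pareto (2 * \<alpha>)) =
      (\<integral>\<^sup>+z. ennreal (2 * \<alpha> * z powr (- (2 * \<alpha>) - 1)) * indicator {1..} z * g (y * z) \<partial>lborel)"
    unfolding pareto_def by (subst nn_integral_density) simp_all
  finally show ?thesis by simp
qed

lemma kendall_dirac_commute: "kendall_dirac \<alpha> x y = kendall_dirac \<alpha> y x"
  by (simp add: kendall_dirac_def max.commute min.commute)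

text \<open>By symmetry let x <= y; x = y = 0 is the default branch of \<open>kendall_dirac\<close>.
  If y > t, both sides vanish, since the kernel lives on [y, \<infinity>). If 0 < y <= t, put a =
  (y/t)^\<alpha> and b = (x/y)^\<alpha>. The exponent 2\<alpha> turns the Pareto integral into the
  square (1 - a)^2, and (1 - b)(1 - a) + b(1 - a)^2 = (1 - ba)(1 - a) with ba =
  (x/t)^\<alpha>.\<close>

lemma nn_integral_williamson_kernel_dirac:
  assumes "0 < \<alpha>" "0 < t" "0 \<le> x" "0 \<le> y"
  shows "(\<integral>\<^sup>+z. ennreal (williamson_kernel \<alpha> t z) \<partial>kendall_dirac \<alpha> x y) =
    ennreal (williamson_kernel \<alpha> t x * williamson_kernel \<alpha> t y)"
  using assms(3,4)
proof (induction x y rule: linorder_wlog)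
  case (sym x y)
  then show ?case by (simp add: kendall_dirac_commute mult.commute)
next
  case (le x y)
  consider "y = 0" | "t < y" | "0 < y" "y \<le> t" using le by linarith
  then show ?case
  proof cases
    case 1
    with le have "x = 0" by simp
    with 1 assms show ?thesis
      by (simp add: kendall_dirac_def nn_integral_return williamson_kernel_def)
  next
    case 2
    have "(\<integral>\<^sup>+z. ennreal (2 * \<alpha> * z powr (- (2 * \<alpha>) - 1)) * indicator {1..} z
        * ennreal (williamson_kernel \<alpha> t (y * z)) \<partial>lborel) = (\<integral>\<^sup>+z. 0 \<partial>(lborel :: real measure))"
    proof (intro nn_integral_cong)
      fix z :: real
      have "t < y * z" if "1 \<le> z"
      proof -
        have "y * 1 \<le> y * z" using that le by (intro mult_left_mono) auto
        with 2 show ?thesis by simp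
      qed
      then show "ennreal (2 * \<alpha> * z powr (- (2 * \<alpha>) - 1)) * indicator {1..} z
        * ennreal (williamson_kernel \<alpha> t (y * z)) = 0"
        by (auto simp: indicator_def williamson_kernel_def)
    qed
    then show ?thesis
      using 2 le assms by (simp add: nn_integral_kendall_dirac) (simp add: williamson_kernel_def)
  next
    case 3
    define T where "T = t / y"
    have T: "1 \<le> T" using 3 by (simp add: T_def)
    have "(\<integral>\<^sup>+z. ennreal (2 * \<alpha> * z powr (- (2 * \<alpha>) - 1)) * indicator {1..} z
        * ennreal (williamson_kernel \<alpha> t (y * z)) \<partial>lborel)
      = (\<integral>\<^sup>+z. ennreal (2 * \<alpha> * z powr (- (2 * \<alpha>) - 1) * (1 - (z / T) powr \<alpha>))
          * indicator {1..T} z \<partial>lborel)"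
      using 3 assms
      by (intro nn_integral_cong)
        (auto simp: T_def indicator_def williamson_kernel_def field_simps mult.commute
          ennreal_mult'[symmetric] simp del: ennreal_mult')
    also have "\<dots> = ennreal ((2 * T powr (-\<alpha>) * T powr (-\<alpha>) - T powr (- (2 * \<alpha>)))
        - (2 * T powr (-\<alpha>) * 1 powr (-\<alpha>) - 1 powr (- (2 * \<alpha>))))"
    \<comment> \<open>Multiplied out, the integrand is 2\<alpha> z^(-2\<alpha>-1) - 2\<alpha>
      T^(-\<alpha>) z^(-\<alpha>-1), whose terms have the antiderivatives -z^(-2\<alpha>) and 2
      T^(-\<alpha>) z^(-\<alpha>).\<close>
    proof (rule nn_integral_FTC_Icc[where F="\<lambda>z. 2 * T powr (-\<alpha>) * z powr (-\<alpha>) - z powr (- (2 * \<alpha>))"])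
      fix z assume "z \<in> {1..T}"
      then have z: "1 \<le> z" "z \<le> T" by auto
      show "((\<lambda>z. 2 * T powr (-\<alpha>) * z powr (-\<alpha>) - z powr (- (2 * \<alpha>))) has_real_derivative
          2 * \<alpha> * z powr (- (2 * \<alpha>) - 1) * (1 - (z / T) powr \<alpha>)) (at z)"
      proof -
        have "z powr (- (2*\<alpha>) - 1) * (z / T) powr \<alpha> = T powr (-\<alpha>) * z powr (-\<alpha> - 1)"
        proof -
          have "(z / T) powr \<alpha> = z powr \<alpha> * T powr (-\<alpha>)"
            using z by (simp add: powr_divide powr_minus field_simps)
          moreover have "z powr (- (2*\<alpha>) - 1) * z powr \<alpha> = z powr (-\<alpha> - 1)"
            using z by (simp add: powr_add[symmetric])
          ultimately show ?thesis by (simp add: mult_ac)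
        qed
        then have e: "2 * \<alpha> * z powr (- (2 * \<alpha>) - 1) * (1 - (z / T) powr \<alpha>) =
          2 * T powr (-\<alpha>) * ((-\<alpha>) * z powr (-\<alpha> - 1)) - (- (2*\<alpha>)) * z powr (- (2 * \<alpha>) - 1)"
          by (simp add: algebra_simps)
        have "((\<lambda>z. z powr p) has_real_derivative p * z powr (p - 1)) (at z)" for p
          using z by (intro has_real_derivative_powr) simp
        note D = this[of "-\<alpha>"] this[of "-(2*\<alpha>)"]
        show ?thesis
          unfolding e
          by (rule derivative_eq_intros D refl)+ simp
      qed
      show "0 \<le> 2 * \<alpha> * z powr (- (2 * \<alpha>) - 1) * (1 - (z / T) powr \<alpha>)"
        using z assms powr_ratio_le_one[of \<alpha> z T] by simp
    qed (use T in auto)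
    also have "(2 * T powr (-\<alpha>) * T powr (-\<alpha>) - T powr (- (2 * \<alpha>)))
        - (2 * T powr (-\<alpha>) * 1 powr (-\<alpha>) - 1 powr (- (2 * \<alpha>))) = (1 - T powr (-\<alpha>))\<^sup>2"
    proof -
      have "T powr (- (2 * \<alpha>)) = T powr (-\<alpha>) * T powr (-\<alpha>)"
        by (simp add: powr_add[symmetric])
      then show ?thesis by (simp add: power2_eq_square algebra_simps)
    qed
    also have "T powr (-\<alpha>) = (y / t) powr \<alpha>"
      using 3 assms by (simp add: T_def powr_minus powr_divide)
    finally have I: "(\<integral>\<^sup>+z. ennreal (2 * \<alpha> * z powr (- (2 * \<alpha>) - 1)) * indicator {1..} z
        * ennreal (williamson_kernel \<alpha> t (y * z)) \<partial>lborel) = ennreal ((1 - (y / t) powr \<alpha>)\<^sup>2)" .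
    define a where "a = (y / t) powr \<alpha>"
    define b where "b = (x / y) powr \<alpha>"
    have ab: "0 \<le> a" "a \<le> 1" "0 \<le> b" "b \<le> 1"
      using le 3 assms by (auto simp: a_def b_def powr_ratio_le_one)
    have "(x / t) powr \<alpha> = b * a"
      using le 3 assms by (simp add: a_def b_def powr_mult[symmetric])
    then have k: "williamson_kernel \<alpha> t x = 1 - b * a" "williamson_kernel \<alpha> t y = 1 - a"
      using le 3 by (auto simp: williamson_kernel_def a_def)
    have "(\<integral>\<^sup>+z. ennreal (williamson_kernel \<alpha> t z) \<partial>kendall_dirac \<alpha> x y)
        = ennreal (1 - b) * ennreal (1 - a) + ennreal b * ennreal ((1 - a)\<^sup>2)"
      using le 3 by (simp add: nn_integral_kendall_dirac I k flip: a_def b_def)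
    also have "\<dots> = ennreal ((1 - b) * (1 - a) + b * (1 - a)\<^sup>2)"
      using ab by (subst ennreal_plus) (simp_all add: ennreal_mult)
    also have "(1 - b) * (1 - a) + b * (1 - a)\<^sup>2 = (1 - b * a) * (1 - a)"
      by (simp add: power2_eq_square algebra_simps)
    finally show ?thesis by (simp add: k)
  qed
qed

text \<open>With a and b as in the Williamson case and x <= y <= t, the mass up to t is (1 - b) +
  b(1 - a^2) = 1 - (ba)a, and ba and a are the two moment kernels. The product stands on the left
  because subtraction of extended nonnegative reals is truncated.\<close>

lemma emeasure_kendall_dirac_atMost:
  assumes "0 < \<alpha>" "0 < t" "0 \<le> x" "0 \<le> y"
  shows "emeasure (kendall_dirac \<alpha> x y) {..t}
      + ennreal (moment_kernel \<alpha> t x * moment_kernel \<alpha> t y) = indicator {..t} x * indicator {..t} y"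
  using assms(3,4)
proof (induction x y rule: linorder_wlog)
  case (sym x y)
  then show ?case by (simp add: kendall_dirac_commute mult.commute)
next
  case (le x y)
  have em: "emeasure (kendall_dirac \<alpha> x y) {..t} = (\<integral>\<^sup>+z. indicator {..t} z \<partial>kendall_dirac \<alpha> x y)"
    by simp
  consider "y = 0" | "t < y" | "0 < y" "y \<le> t" using le by linarith
  then show ?case
  proof cases
    case 1
    with le have "x = 0" by simp
    with 1 assms show ?thesis
      by (simp add: kendall_dirac_def moment_kernel_def)
  next
    case 2
    have "(\<integral>\<^sup>+z. ennreal (2 * \<alpha> * z powr (- (2 * \<alpha>) - 1)) * indicator {1..} z
        * indicator {..t} (y * z) \<partial>lborel) = (\<integral>\<^sup>+z. 0 \<partial>(lborel :: real measure))"
    proof (intro nn_integral_cong)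
      fix z :: real
      have "t < y * z" if "1 \<le> z"
      proof -
        have "y * 1 \<le> y * z" using that le by (intro mult_left_mono) auto
        with 2 show ?thesis by simp
      qed
      then show "ennreal (2 * \<alpha> * z powr (- (2 * \<alpha>) - 1)) * indicator {1..} z
        * indicator {..t} (y * z) = 0"
        by (auto simp: indicator_def)
    qed
    then show ?thesis
      unfolding em
      using 2 le assms
      by (simp add: nn_integral_kendall_dirac del: nn_integral_indicator)
        (simp add: moment_kernel_def)
  next
    case 3
    define T where "T = t / y"
    have T: "1 \<le> T" using 3 by (simp add: T_def)
    have "(\<integral>\<^sup>+z. ennreal (2 * \<alpha> * z powr (- (2 * \<alpha>) - 1)) * indicator {1..} z
        * indicator {..t} (y * z) \<partial>lborel)
      = (\<integral>\<^sup>+z. ennreal (2 * \<alpha> * z powr (- (2 * \<alpha>) - 1)) * indicator {1..T} z \<partial>lborel)"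
      using 3 assms
      by (intro nn_integral_cong) (auto simp: T_def indicator_def field_simps)
    also have "\<dots> = ennreal (- (T powr (- (2 * \<alpha>))) - - (1 powr (- (2 * \<alpha>))))"
    proof (rule nn_integral_FTC_Icc[where F="\<lambda>z. - (z powr (- (2 * \<alpha>)))"])
      fix z assume "z \<in> {1..T}"
      then have z: "1 \<le> z" "z \<le> T" by auto
      have "((\<lambda>z. z powr p) has_real_derivative p * z powr (p - 1)) (at z)" for p
        using z by (intro has_real_derivative_powr) simp
      note D = this[of "-(2*\<alpha>)"]
      show "((\<lambda>z. - (z powr (- (2 * \<alpha>)))) has_real_derivative
          2 * \<alpha> * z powr (- (2 * \<alpha>) - 1)) (at z)"
        by (rule derivative_eq_intros D refl)+ simp
      show "0 \<le> 2 * \<alpha> * z powr (- (2 * \<alpha>) - 1)" using assms by simp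
    qed (use T in auto)
    also have "- (T powr (- (2 * \<alpha>))) - - (1 powr (- (2 * \<alpha>))) = 1 - ((y / t) powr \<alpha>)\<^sup>2"
      using 3 assms by (simp add: T_def powr_minus powr_divide power2_eq_square powr_add[symmetric])
    finally have I: "(\<integral>\<^sup>+z. ennreal (2 * \<alpha> * z powr (- (2 * \<alpha>) - 1)) * indicator {1..} z
        * indicator {..t} (y * z) \<partial>lborel) = ennreal (1 - ((y / t) powr \<alpha>)\<^sup>2)" .
    define a where "a = (y / t) powr \<alpha>"
    define b where "b = (x / y) powr \<alpha>"
    have ab: "0 \<le> a" "a \<le> 1" "0 \<le> b" "b \<le> 1"
      using le 3 assms by (auto simp: a_def b_def powr_ratio_le_one)
    have "a * a \<le> 1" using ab by (simp add: mult_le_one)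
    moreover have "(x / t) powr \<alpha> = b * a"
      using le 3 assms by (simp add: a_def b_def powr_mult[symmetric])
    ultimately have a2: "a\<^sup>2 \<le> 1" and
      k: "moment_kernel \<alpha> t x = b * a" "moment_kernel \<alpha> t y = a"
      using le 3 by (auto simp: moment_kernel_def a_def power2_eq_square)
    have "emeasure (kendall_dirac \<alpha> x y) {..t} + ennreal (moment_kernel \<alpha> t x * moment_kernel \<alpha> t y)
        = ennreal (1 - b) + ennreal b * ennreal (1 - a\<^sup>2) + ennreal (b * a * a)"
      unfolding em using le 3
      by (simp add: nn_integral_kendall_dirac I k del: nn_integral_indicator flip: a_def b_def)
    also have "\<dots> = ennreal ((1 - b) + b * (1 - a\<^sup>2) + b * a * a)"
      using ab a2 by (simp add: ennreal_mult ennreal_plus)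
    also have "(1 - b) + b * (1 - a\<^sup>2) + b * a * a = 1"
      by (simp add: power2_eq_square algebra_simps)
    finally show ?thesis using le 3 by simp
  qed
qed

section \<open>Transforms of laws and their behaviour under convolution\<close>

definition williamson :: "real \<Rightarrow> real measure \<Rightarrow> real \<Rightarrow> real" where
  "williamson \<alpha> \<mu> t = (LINT x|\<mu>. williamson_kernel \<alpha> t x)"

text \<open>For t > 0 this is \<open>truncated_moment \<alpha> \<mu> t\<close> divided by
  t^\<alpha>, the h of the overview.\<close>

definition scaled_moment :: "real \<Rightarrow> real measure \<Rightarrow> real \<Rightarrow> real" where
  "scaled_moment \<alpha> \<mu> t = (LINT x|\<mu>. moment_kernel \<alpha> t x)"

lemma scaled_moment_nonneg [simp]: "0 \<le> scaled_moment \<alpha> \<mu> t"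
  by (simp add: scaled_moment_def)

lemma williamson_return: "williamson \<alpha> (return borel x) t = williamson_kernel \<alpha> t x"
  by (simp add: williamson_def integral_return)

lemma scaled_moment_return: "scaled_moment \<alpha> (return borel x) t = moment_kernel \<alpha> t x"
  by (simp add: scaled_moment_def integral_return)

lemma P_plusD:
  assumes "\<mu> \<in> P_plus"
  shows "real_distribution \<mu>" "AE x in \<mu>. 0 \<le> x"
  using assms by (auto simp: P_plus_def)

lemma return_in_P_plus: "0 \<le> x \<Longrightarrow> return borel x \<in> P_plus"
  by (auto simp: P_plus_def real_distribution_def real_distribution_axioms_def AE_return
      intro!: prob_space_return)

context
  fixes \<alpha> t :: real and \<mu> :: "real measure"
  assumes alpha: "0 < \<alpha>" and t: "0 < t" and mu: "\<mu> \<in> P_plus"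
begin

interpretation real_distribution \<mu> using P_plusD[OF mu] by simp

lemma integrable_moment_kernel: "integrable \<mu> (moment_kernel \<alpha> t)"
  using moment_kernel_le_one[OF alpha t] by (intro integrable_const_bound[where B=1]) auto

lemma integrable_williamson_kernel: "integrable \<mu> (williamson_kernel \<alpha> t)"
  using williamson_kernel_nonneg[OF alpha t] williamson_kernel_le_one
  by (intro integrable_const_bound[where B=1]) auto

lemma nn_integral_moment_kernel:
  "(\<integral>\<^sup>+x. ennreal (moment_kernel \<alpha> t x) \<partial>\<mu>) = ennreal (scaled_moment \<alpha> \<mu> t)"
  unfolding scaled_moment_def
  by (intro nn_integral_eq_integral integrable_moment_kernel) auto

lemma nn_integral_williamson_kernel:
  "(\<integral>\<^sup>+x. ennreal (williamson_kernel \<alpha> t x) \<partial>\<mu>) = ennreal (williamson \<alpha> \<mu> t)"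
  unfolding williamson_def
  using williamson_kernel_nonneg[OF alpha t]
  by (intro nn_integral_eq_integral integrable_williamson_kernel) auto

lemma williamson_nonneg: "0 \<le> williamson \<alpha> \<mu> t"
  using williamson_kernel_nonneg[OF alpha t] by (simp add: williamson_def)

lemma cdf_eq_williamson_plus_scaled_moment:
  "cdf \<mu> t = williamson \<alpha> \<mu> t + scaled_moment \<alpha> \<mu> t"
proof -
  have "williamson \<alpha> \<mu> t + scaled_moment \<alpha> \<mu> t = (LINT x|\<mu>. indicator {0..t} x)"
    unfolding williamson_def scaled_moment_def
    by (simp add: Bochner_Integration.integral_add[symmetric] integrable_moment_kernel
        integrable_williamson_kernel williamson_plus_moment_kernel del: integral_indicator)
  also have "\<dots> = (LINT x|\<mu>. indicator {..t} x)"
    using P_plusD(2)[OF mu] by (intro integral_cong_AE) (auto simp: indicator_def)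
  finally show ?thesis by (simp add: cdf_def)
qed

end

context
  fixes \<alpha> :: real and \<mu> \<nu> :: "real measure"
  assumes alpha: "0 < \<alpha>" and mu: "\<mu> \<in> P_plus" and nu: "\<nu> \<in> P_plus"
begin

interpretation m: real_distribution \<mu> using P_plusD[OF mu] by simp
interpretation n: real_distribution \<nu> using P_plusD[OF nu] by simp

lemma kendall_dirac_measurable2:
  "kendall_dirac \<alpha> x \<in> \<nu> \<rightarrow>\<^sub>M subprob_algebra borel"
  using measurable_compose[OF measurable_Pair1' measurable_kendall_dirac[OF alpha], of x] by simp

lemma nn_integral_kendall_conv:
  assumes "g \<in> borel_measurable borel"
  shows "(\<integral>\<^sup>+z. g z \<partial>kendall_conv \<alpha> \<mu> \<nu>) =
    (\<integral>\<^sup>+x. \<integral>\<^sup>+y. \<integral>\<^sup>+z. g z \<partial>kendall_dirac \<alpha> x y \<partial>\<nu> \<partial>\<mu>)"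
proof -
  have "(\<lambda>x. \<nu> \<bind> kendall_dirac \<alpha> x) \<in> \<mu> \<rightarrow>\<^sub>M subprob_algebra borel"
    using measurable_kendall_dirac_bind[OF alpha] n.real_distribution_axioms by simp
  then show ?thesis
    unfolding kendall_conv_def
    by (simp add: nn_integral_bind[OF assms] kendall_dirac_measurable2)
qed

text \<open>The kernel identities hold only at nonnegative points, so nonnegativity has to survive
  convolution before they can be applied to powers.\<close>

lemma kendall_conv_in_P_plus: "kendall_conv \<alpha> \<mu> \<nu> \<in> P_plus"
proof -
  have "real_distribution (kendall_conv \<alpha> \<mu> \<nu>)"
    using alpha m.real_distribution_axioms n.real_distribution_axioms
    by (rule real_distribution_kendall_conv)
  then interpret c: real_distribution "kendall_conv \<alpha> \<mu> \<nu>" .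
  \<comment> \<open>For negative x or y the default value of \<open>kendall_dirac\<close> is the
    Dirac measure at 0, so this can be integrated over all real x and y.\<close>
  have z: "emeasure (kendall_dirac \<alpha> x y) {..<0} = 0" for x y
  proof (cases "0 \<le> min x y \<and> 0 < max x y")
    case True
    define d where "d = max x y"
    have "(\<lambda>z. d * z) -` {..<0} \<inter> space borel = {..<0}"
      using True by (auto simp: d_def mult_less_0_iff)
    moreover have "emeasure (pareto (2 * \<alpha>)) {..<0} = (\<integral>\<^sup>+z. 0 \<partial>(lborel :: real measure))"
      unfolding pareto_def
      by (subst emeasure_density) (auto intro!: nn_integral_zero' simp: indicator_def)
    ultimately show ?thesis
      using True by (simp add: kendall_dirac_def emeasure_distr emeasure_kendall_unit flip: d_def)
  next
    case False
    then show ?thesis by (auto simp: kendall_dirac_def)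
  qed
  have "emeasure (kendall_conv \<alpha> \<mu> \<nu>) {..<0} = 0"
    by (simp add: emeasure_kendall_conv alpha m.real_distribution_axioms n.real_distribution_axioms z)
  then have "AE x in kendall_conv \<alpha> \<mu> \<nu>. 0 \<le> x"
    by (intro AE_I[where N="{..<0}"]) auto
  then show ?thesis using c.real_distribution_axioms by (simp add: P_plus_def)
qed

context
  fixes t :: real
  assumes t: "0 < t"
begin

text \<open>Multiplicativity passes from Dirac measures to all laws on the half-line by integrating
  the kernel identity over x and y.\<close>

lemma williamson_kendall_conv:
  "williamson \<alpha> (kendall_conv \<alpha> \<mu> \<nu>) t = williamson \<alpha> \<mu> t * williamson \<alpha> \<nu> t"
proof -
  let ?K = "williamson_kernel \<alpha> t"
  note nn = williamson_kernel_nonneg[OF alpha t]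
  have "ennreal (williamson \<alpha> (kendall_conv \<alpha> \<mu> \<nu>) t) =
      (\<integral>\<^sup>+x. \<integral>\<^sup>+y. \<integral>\<^sup>+z. ennreal (?K z) \<partial>kendall_dirac \<alpha> x y \<partial>\<nu> \<partial>\<mu>)"
    by (simp add: nn_integral_kendall_conv
        flip: nn_integral_williamson_kernel[OF alpha t kendall_conv_in_P_plus])
  also have "\<dots> = (\<integral>\<^sup>+x. \<integral>\<^sup>+y. ennreal (?K x) * ennreal (?K y) \<partial>\<nu> \<partial>\<mu>)"
  proof (rule nn_integral_cong_AE)
    show "AE x in \<mu>. (\<integral>\<^sup>+y. \<integral>\<^sup>+z. ennreal (?K z) \<partial>kendall_dirac \<alpha> x y \<partial>\<nu>)
        = (\<integral>\<^sup>+y. ennreal (?K x) * ennreal (?K y) \<partial>\<nu>)"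
      using P_plusD(2)[OF mu]
    proof eventually_elim
      case (elim x)
      show ?case
        using P_plusD(2)[OF nu] elim
        by (intro nn_integral_cong_AE)
          (auto simp: nn_integral_williamson_kernel_dirac alpha t ennreal_mult nn)
    qed
  qed
  also have "\<dots> = ennreal (williamson \<alpha> \<mu> t) * ennreal (williamson \<alpha> \<nu> t)"
    by (simp add: nn_integral_cmult nn_integral_multc nn_integral_williamson_kernel alpha t mu nu)
  also have "\<dots> = ennreal (williamson \<alpha> \<mu> t * williamson \<alpha> \<nu> t)"
    by (simp add: ennreal_mult' williamson_nonneg alpha t mu nu)
  finally show ?thesis
    by (simp add: williamson_nonneg alpha t mu nu kendall_conv_in_P_plus)
qed

text \<open>This integrates \<open>emeasure_kendall_dirac_atMost\<close>. With F = W + h the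
  right-hand side is the product of the two W plus the two mixed terms W h: removing the product of
  the h is the rule \<epsilon>^2 = 0.\<close>

lemma cdf_kendall_conv:
  "cdf (kendall_conv \<alpha> \<mu> \<nu>) t = cdf \<mu> t * cdf \<nu> t - scaled_moment \<alpha> \<mu> t * scaled_moment \<alpha> \<nu> t"
proof -
  let ?k = "moment_kernel \<alpha> t"
  interpret c: real_distribution "kendall_conv \<alpha> \<mu> \<nu>"
    using P_plusD[OF kendall_conv_in_P_plus] by simp
  \<comment> \<open>Measurability in y, and of the inner integral in x, allows the integral of the
    sum below to be split.\<close>
  have meas: "(\<lambda>y. emeasure (kendall_dirac \<alpha> x y) {..t}) \<in> borel_measurable \<nu>" for x
    using measurable_compose[OF kendall_dirac_measurable2 measurable_emeasure_subprob_algebra] by simp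
  have "(\<lambda>w. emeasure (kendall_dirac \<alpha> (fst w) (snd w)) {..t}) \<in> borel_measurable (borel \<Otimes>\<^sub>M borel)"
    using measurable_compose[OF measurable_kendall_dirac[OF alpha] measurable_emeasure_subprob_algebra]
    by simp
  then have "(\<lambda>(x, y). emeasure (kendall_dirac \<alpha> x y) {..t}) \<in> borel_measurable (\<mu> \<Otimes>\<^sub>M \<nu>)"
    by (simp add: case_prod_beta' cong: measurable_cong_sets sets_pair_measure_cong)
  then have meas2: "(\<lambda>x. \<integral>\<^sup>+y. emeasure (kendall_dirac \<alpha> x y) {..t} \<partial>\<nu>) \<in> borel_measurable \<mu>"
    by (rule n.borel_measurable_nn_integral)
  have "ennreal (scaled_moment \<alpha> \<mu> t) * ennreal (scaled_moment \<alpha> \<nu> t)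
      = (\<integral>\<^sup>+x. \<integral>\<^sup>+y. ennreal (?k x) * ennreal (?k y) \<partial>\<nu> \<partial>\<mu>)"
    by (simp add: nn_integral_cmult nn_integral_multc nn_integral_moment_kernel alpha t mu nu)
  then have "emeasure (kendall_conv \<alpha> \<mu> \<nu>) {..t}
        + ennreal (scaled_moment \<alpha> \<mu> t) * ennreal (scaled_moment \<alpha> \<nu> t)
      = (\<integral>\<^sup>+x. \<integral>\<^sup>+y. emeasure (kendall_dirac \<alpha> x y) {..t} + ennreal (?k x) * ennreal (?k y) \<partial>\<nu> \<partial>\<mu>)"
    using meas meas2
    by (simp add: emeasure_kendall_conv alpha m.real_distribution_axioms n.real_distribution_axioms
        nn_integral_add)
  also have "\<dots> = (\<integral>\<^sup>+x. \<integral>\<^sup>+y. indicator {..t} x * indicator {..t} y \<partial>\<nu> \<partial>\<mu>)"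
  proof (rule nn_integral_cong_AE)
    show "AE x in \<mu>.
      (\<integral>\<^sup>+y. emeasure (kendall_dirac \<alpha> x y) {..t} + ennreal (?k x) * ennreal (?k y) \<partial>\<nu>)
        = (\<integral>\<^sup>+y. indicator {..t} x * indicator {..t} y \<partial>\<nu>)"
      using P_plusD(2)[OF mu]
    proof eventually_elim
      case (elim x)
      show ?case
        using P_plusD(2)[OF nu] elim
        by (intro nn_integral_cong_AE)
          (auto simp: emeasure_kendall_dirac_atMost[OF alpha t, symmetric] ennreal_mult)
    qed
  qed
  also have "\<dots> = emeasure \<mu> {..t} * emeasure \<nu> {..t}"
    by (simp add: nn_integral_cmult nn_integral_multc)
  finally have "ennreal (cdf (kendall_conv \<alpha> \<mu> \<nu>) t + scaled_moment \<alpha> \<mu> t * scaled_moment \<alpha> \<nu> t)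
      = ennreal (cdf \<mu> t * cdf \<nu> t)"
    by (simp add: cdf_def c.emeasure_eq_measure m.emeasure_eq_measure n.emeasure_eq_measure
        ennreal_mult alpha t mu nu)
  then have "cdf (kendall_conv \<alpha> \<mu> \<nu>) t + scaled_moment \<alpha> \<mu> t * scaled_moment \<alpha> \<nu> t
      = cdf \<mu> t * cdf \<nu> t"
    by (subst (asm) ennreal_inj) (auto simp: cdf_def alpha t mu nu)
  then show ?thesis by simp
qed

end

end

lemma kendall_power_in_P_plus: "0 < \<alpha> \<Longrightarrow> \<nu> \<in> P_plus \<Longrightarrow> kendall_power \<alpha> \<nu> n \<in> P_plus"
  by (induction n) (auto intro: return_in_P_plus kendall_conv_in_P_plus)

context
  fixes \<alpha> t :: real and \<nu> :: "real measure"
  assumes alpha: "0 < \<alpha>" and t: "0 < t" and nu: "\<nu> \<in> P_plus"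
begin

lemma williamson_kendall_power: "williamson \<alpha> (kendall_power \<alpha> \<nu> n) t = williamson \<alpha> \<nu> t ^ n"
proof (induction n)
  case 0
  then show ?case using alpha t by (simp add: williamson_return williamson_kernel_def)
next
  case (Suc n)
  then show ?case
    by (simp add: williamson_kendall_conv alpha t nu kendall_power_in_P_plus mult.commute)
qed

text \<open>For \<open>n = 0\<close> the truncated subtraction is harmless, because of the factor \<open>n\<close>.\<close>
lemma scaled_moment_kendall_power:
  "scaled_moment \<alpha> (kendall_power \<alpha> \<nu> n) t
    = real n * williamson \<alpha> \<nu> t ^ (n - 1) * scaled_moment \<alpha> \<nu> t"
proof (induction n)
  case 0
  then show ?case using alpha t by (simp add: scaled_moment_return moment_kernel_def)
next
  case (Suc n)
  let ?p = "kendall_power \<alpha> \<nu> n"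
  have p: "?p \<in> P_plus" using alpha nu by (rule kendall_power_in_P_plus)
  \<comment> \<open>The Leibniz rule: in the two expressions for the distribution function of the
    convolution the products of Williamson transforms cancel, and the mixed terms remain.\<close>
  have "scaled_moment \<alpha> (kendall_conv \<alpha> ?p \<nu>) t
      = scaled_moment \<alpha> ?p t * williamson \<alpha> \<nu> t + williamson \<alpha> ?p t * scaled_moment \<alpha> \<nu> t"
    using cdf_kendall_conv[OF alpha p nu t] williamson_kendall_conv[OF alpha p nu t]
      cdf_eq_williamson_plus_scaled_moment[OF alpha t kendall_conv_in_P_plus[OF alpha p nu]]
      cdf_eq_williamson_plus_scaled_moment[OF alpha t p]
      cdf_eq_williamson_plus_scaled_moment[OF alpha t nu]
    by (simp add: algebra_simps)
  then show ?case
    unfolding kendall_power.simps Suc williamson_kendall_power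
    by (cases n) (simp_all add: algebra_simps)
qed

end

section \<open>The renewal function\<close>

lemma cdf_return: "cdf (return borel x) t = indicator {..t} x"
  by (simp add: cdf_def measure_return)

text \<open>The transition kernel becomes an explicit function of the current position x. That it
  vanishes for x > t makes the walk nondecreasing.\<close>

lemma cdf_kendall_conv_return:
  assumes "0 < \<alpha>" "\<mu> \<in> P_plus" "0 < t" "0 \<le> x"
  shows "cdf (kendall_conv \<alpha> (return borel x) \<mu>) t
    = indicator {..t} x * cdf \<mu> t - moment_kernel \<alpha> t x * scaled_moment \<alpha> \<mu> t"
  using assms
  by (simp add: cdf_kendall_conv return_in_P_plus scaled_moment_return cdf_return)

text \<open>Since \<open>P\<close> holds exactly on an initial segment, the first failure is also
  the number of successes. If \<open>P\<close> never fails, both sides are infinite, the infimum of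
  the empty set being \<infinity>.\<close>

lemma ennreal_of_enat_Inf_eq_suminf:
  assumes "\<And>n. P (Suc n) \<Longrightarrow> P n"
  shows "ennreal_of_enat (Inf {enat n |n. \<not> P n}) = (\<Sum>n. indicator {n. P n} n)"
proof (cases "\<exists>n. \<not> P n")
  case True
  define k where "k = (LEAST n. \<not> P n)"
  have k: "\<not> P k" "\<And>n. n < k \<Longrightarrow> P n"
    using LeastI_ex[OF True] unfolding k_def by (auto dest: not_less_Least)
  have "\<not> P (k + i)" for i using k(1) assms by (induction i) auto
  then have "P n \<longleftrightarrow> n < k" for n
    using k(2) by (metis le_add_diff_inverse not_le)
  then have P: "{n. P n} = {..<k}" by auto
  have "Inf {enat n |n. \<not> P n} = enat k"
    using k by (intro cInf_eq_minimum) (force simp: not_less[symmetric])+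
  moreover have "(\<Sum>n. indicator {n. P n} n :: ennreal) = (\<Sum>n<k. indicator {n. P n} n)"
    by (rule suminf_finite) (auto simp: P)
  ultimately show ?thesis by (simp add: P ennreal_of_nat_eq_real_of_nat)
next
  case False
  then have "(\<Sum>n. indicator {n. P n} n :: ennreal) = \<infinity>"
    by (simp add: suminf_eq_SUP ennreal_SUP_of_nat_eq_top)
  with False show ?thesis by (simp add: Inf_enat_def)
qed

context kendall_random_walk
begin

lemma S_measurable [measurable]: "S (Suc n) \<in> borel_measurable M"
  using random_variable by simp

lemma distr_S_Suc_0: "distr M borel (S (Suc 0)) = \<nu>"
  using initial by simp

lemma subalgebra_past: "subalgebra M (past M S k)"
proof -
  have "{S i -` A \<inter> space M | i A. 1 \<le> i \<and> i \<le> k \<and> A \<in> sets borel} \<subseteq> sets M"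
    using random_variable by (auto intro: measurable_sets)
  then show ?thesis
    unfolding subalgebra_def past_def
    using sets.sigma_sets_subset[of _ M] sets.space_closed[of M]
    by (auto simp: sets_measure_of_conv space_measure_of_conv)
qed

lemma sigma_finite_subalgebra_past: "sigma_finite_subalgebra M (past M S k)"
  using subalgebra_past
  by (intro finite_measure_subalgebra_is_sigma_finite)
    (auto simp: finite_measure_subalgebra_def finite_measure_subalgebra_axioms_def
      finite_measure_axioms)

context
  assumes alpha: "0 < \<alpha>" and nu: "\<nu> \<in> P_plus"
begin

lemma AE_S_Suc_0_nonneg: "AE \<omega> in M. 0 \<le> S (Suc 0) \<omega>"
proof -
  have "AE x in distr M borel (S (Suc 0)). 0 \<le> x"
    unfolding distr_S_Suc_0 by (rule P_plusD(2)[OF nu])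
  then show ?thesis by (subst (asm) AE_distr_iff) auto
qed

context
  fixes t :: real
  assumes t: "0 < t"
begin

text \<open>Condition on \<open>S 1\<close>, whose law is \<nu>: the remaining n steps form a
  transition whose distribution function is explicit in the starting point and can be integrated
  against \<nu>.\<close>

lemma prob_S_Suc_le:
  "prob {\<omega> \<in> space M. S (Suc n) \<omega> \<le> t} = cdf (kendall_conv \<alpha> \<nu> (kendall_power \<alpha> \<nu> n)) t"
proof (cases n)
  \<comment> \<open>With no step left the Markov property says nothing; convolution with the Dirac
    measure at 0 does not change the distribution function at t.\<close>
  case 0
  have "prob {\<omega> \<in> space M. S (Suc 0) \<omega> \<le> t} = cdf (distr M borel (S (Suc 0))) t"
    by (simp add: cdf_def measure_distr vimage_def Int_def conj_commute)
  then show ?thesis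
    using 0 initial cdf_kendall_conv[OF alpha nu return_in_P_plus t, of 0] alpha t
    by (simp add: cdf_return scaled_moment_return moment_kernel_def)
next
  case (Suc m)
  interpret sigma_finite_subalgebra M "past M S 1" by (rule sigma_finite_subalgebra_past)
  let ?p = "kendall_power \<alpha> \<nu> n"
  have p: "?p \<in> P_plus" using alpha nu by (rule kendall_power_in_P_plus)
  interpret n: real_distribution \<nu> using P_plusD[OF nu] by simp
  \<comment> \<open>A function on the whole line that agrees with the n-step transition probability
    at nonnegative starting points, hence almost surely at \<open>S 1\<close>.\<close>
  define g where "g x = indicator {..t} x * cdf ?p t - moment_kernel \<alpha> t x * scaled_moment \<alpha> ?p t" for x
  have [measurable]: "g \<in> borel_measurable borel" unfolding g_def by measurable
  have "prob {\<omega> \<in> space M. S (Suc n) \<omega> \<le> t} = (\<integral>\<omega>. indicator {\<omega> \<in> space M. S (Suc n) \<omega> \<le> t} \<omega> \<partial>M)"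
    by simp
  also have "\<dots> = (\<integral>\<omega>. indicator {..t} (S (Suc n) \<omega>) \<partial>M)"
    by (intro Bochner_Integration.integral_cong) (auto simp: indicator_def)
  also have "\<dots> = (\<integral>\<omega>. real_cond_exp M (past M S 1) (\<lambda>\<omega>. indicator {..t} (S (Suc n) \<omega>)) \<omega> \<partial>M)"
    by (intro real_cond_exp_int(2)[symmetric] integrable_const_bound[where B=1]) auto
  also have "\<dots> = (\<integral>\<omega>. g (S (Suc 0) \<omega>) \<partial>M)"
  proof (rule integral_cong_AE)
    have "AE \<omega> in M. real_cond_exp M (past M S 1) (\<lambda>\<omega>'. indicator {..t} (S (Suc n) \<omega>')) \<omega>
        = measure (kendall_conv \<alpha> (return borel (S 1 \<omega>)) (kendall_power \<alpha> \<nu> (Suc n - 1))) {..t}"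
      using Suc by (intro markov) auto
    then show "AE \<omega> in M. real_cond_exp M (past M S 1) (\<lambda>\<omega>. indicator {..t} (S (Suc n) \<omega>)) \<omega>
        = g (S (Suc 0) \<omega>)"
      using AE_S_Suc_0_nonneg
    proof eventually_elim
      case (elim \<omega>)
      then show ?case
        using cdf_kendall_conv_return[OF alpha p t elim(2)] by (simp add: cdf_def g_def)
    qed
  qed measurable
  also have "\<dots> = (\<integral>x. g x \<partial>distr M borel (S (Suc 0)))"
    by (simp add: integral_distr)
  also have "\<dots> = (\<integral>x. g x \<partial>\<nu>)"
    by (simp only: distr_S_Suc_0)
  also have "\<dots> = cdf \<nu> t * cdf ?p t - scaled_moment \<alpha> \<nu> t * scaled_moment \<alpha> ?p t"
    unfolding g_def
    by (subst Bochner_Integration.integral_diff)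
      (auto intro!: integrable_mult_left integrable_moment_kernel[OF alpha t nu]
        simp: cdf_def scaled_moment_def n.emeasure_eq_measure)
  finally show ?thesis by (simp add: cdf_kendall_conv alpha nu t p)
qed

text \<open>Write w and h for the transforms of \<nu>. Then (w + h)(w^n + n w^(n-1) h) - h (n
  w^(n-1) h) is the claimed value, since the terms in h^2 cancel.\<close>

lemma prob_S_Suc_le_explicit:
  "prob {\<omega> \<in> space M. S (Suc n) \<omega> \<le> t} =
    williamson \<alpha> \<nu> t ^ Suc n + real (Suc n) * williamson \<alpha> \<nu> t ^ n * scaled_moment \<alpha> \<nu> t"
proof -
  have p: "kendall_power \<alpha> \<nu> n \<in> P_plus" using alpha nu by (rule kendall_power_in_P_plus)
  show ?thesis
    using cdf_eq_williamson_plus_scaled_moment[OF alpha t p]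
      cdf_eq_williamson_plus_scaled_moment[OF alpha t nu]
    unfolding prob_S_Suc_le cdf_kendall_conv[OF alpha nu p t] williamson_kendall_power[OF alpha t nu]
      scaled_moment_kendall_power[OF alpha t nu]
    by (cases n) (simp_all add: algebra_simps)
qed

text \<open>A position above t is left only to positions above t: the event that
  \<open>S (Suc n)\<close> exceeds t belongs to the past, and on it the conditional probability of
  falling back to t or below is 0. A single level suffices for the first passage over t.\<close>

lemma AE_S_le_antimono: "AE \<omega> in M. S (Suc (Suc n)) \<omega> \<le> t \<longrightarrow> S (Suc n) \<omega> \<le> t"
proof -
  interpret sigma_finite_subalgebra M "past M S (Suc n)" by (rule sigma_finite_subalgebra_past)
  let ?p = "kendall_power \<alpha> \<nu> (Suc (Suc n) - Suc n)"
  have p: "?p \<in> P_plus" using alpha nu by (rule kendall_power_in_P_plus)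
  define A where "A = S (Suc n) -` {t<..} \<inter> space M"
  have A: "A \<in> sets (past M S (Suc n))"
    unfolding past_def A_def by (intro in_measure_of) (auto, force)
  have [measurable]: "A \<in> sets M" unfolding A_def by measurable
  have "AE \<omega> in M. real_cond_exp M (past M S (Suc n)) (\<lambda>\<omega>'. indicator {..t} (S (Suc (Suc n)) \<omega>')) \<omega>
      = measure (kendall_conv \<alpha> (return borel (S (Suc n) \<omega>)) ?p) {..t}"
    by (intro markov) auto
  then have z: "AE \<omega> in M. indicator A \<omega> *\<^sub>R
      real_cond_exp M (past M S (Suc n)) (\<lambda>\<omega>'. indicator {..t} (S (Suc (Suc n)) \<omega>')) \<omega> = 0"
  proof eventually_elim
    case (elim \<omega>)
    show ?case
    proof (cases "\<omega> \<in> A")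
      \<comment> \<open>On \<open>A\<close> the position exceeds t > 0, so the transition formula
        applies and both of its terms vanish.\<close>
      case True
      then have "t < S (Suc n) \<omega>" by (simp add: A_def)
      then show ?thesis
        using elim cdf_kendall_conv_return[OF alpha p t, of "S (Suc n) \<omega>"] t
        by (simp add: cdf_def moment_kernel_def)
    qed simp
  qed
  \<comment> \<open>As \<open>A\<close> lies in the past, the integral over \<open>A\<close> is that
    of the conditional expectation, hence 0; the integrand is nonnegative and so vanishes almost
    everywhere.\<close>
  have "(\<integral>\<omega>\<in>A. indicator {..t} (S (Suc (Suc n)) \<omega>) \<partial>M) =
    (\<integral>\<omega>\<in>A. real_cond_exp M (past M S (Suc n)) (\<lambda>\<omega>'. indicator {..t} (S (Suc (Suc n)) \<omega>')) \<omega> \<partial>M)"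
    by (intro real_cond_exp_intA A integrable_const_bound[where B=1]) auto
  also have "\<dots> = 0"
    unfolding set_lebesgue_integral_def using z by (intro integral_eq_zero_AE)
  finally have "(\<integral>\<omega>. indicator A \<omega> * indicator {..t} (S (Suc (Suc n)) \<omega>) \<partial>M) = (0 :: real)"
    by (simp add: set_lebesgue_integral_def)
  then have "AE \<omega> in M. indicator A \<omega> * indicator {..t} (S (Suc (Suc n)) \<omega>) = (0 :: real)"
    by (subst (asm) integral_nonneg_eq_0_iff_AE)
      (auto intro!: integrable_const_bound[where B=1] simp: indicator_def)
  then show ?thesis
    by (auto simp: A_def indicator_def split: if_splits)
qed

text \<open>Almost surely all countably many monotonicity statements hold at once, and then N(t)
  counts the n >= 0 with \<open>S (Suc n)\<close> at most t.\<close>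

lemma renewal_function_eq_suminf:
  "renewal_function M S t = (\<Sum>n. emeasure M {\<omega> \<in> space M. S (Suc n) \<omega> \<le> t})"
proof -
  have "AE \<omega> in M. \<forall>n. S (Suc (Suc n)) \<omega> \<le> t \<longrightarrow> S (Suc n) \<omega> \<le> t"
    by (simp add: AE_all_countable AE_S_le_antimono)
  then have "AE \<omega> in M. ennreal_of_enat (renewal_process S t \<omega>)
      = (\<Sum>n. indicator {\<omega> \<in> space M. S (Suc n) \<omega> \<le> t} \<omega>)"
    using AE_space
  proof eventually_elim
    case (elim \<omega>)
    have "renewal_process S t \<omega> = Inf {enat n |n. \<not> S (Suc n) \<omega> \<le> t}"
      by (simp add: renewal_process_def not_le)
    then show ?case
      using elim ennreal_of_enat_Inf_eq_suminf[of "\<lambda>n. S (Suc n) \<omega> \<le> t"]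
      by (simp add: indicator_def)
  qed
  then have "renewal_function M S t = (\<integral>\<^sup>+\<omega>. (\<Sum>n. indicator {\<omega> \<in> space M. S (Suc n) \<omega> \<le> t} \<omega>) \<partial>M)"
    unfolding renewal_function_def by (rule nn_integral_cong_AE)
  then show ?thesis by (simp add: nn_integral_suminf)
qed

text \<open>The explicit probabilities sum by the geometric series and its derivative, which
  converge because w < 1.\<close>

lemma renewal_function_eq:
  assumes "williamson \<alpha> \<nu> t < 1"
  shows "renewal_function M S t =
    ennreal (williamson \<alpha> \<nu> t / (1 - williamson \<alpha> \<nu> t)
      + scaled_moment \<alpha> \<nu> t / (1 - williamson \<alpha> \<nu> t)\<^sup>2)"
proof -
  let ?w = "williamson \<alpha> \<nu> t" and ?h = "scaled_moment \<alpha> \<nu> t"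
  have w: "0 \<le> ?w" "norm ?w < 1" using williamson_nonneg[OF alpha t nu] assms by auto
  have "(\<lambda>n. ?w * ?w ^ n + ?h * (of_nat (Suc n) * ?w ^ n)) sums
      (?w * (1 / (1 - ?w)) + ?h * (1 / (1 - ?w)\<^sup>2))"
    by (intro sums_add sums_mult geometric_sums geometric_deriv_sums w)
  then have "(\<lambda>n. prob {\<omega> \<in> space M. S (Suc n) \<omega> \<le> t}) sums (?w / (1 - ?w) + ?h / (1 - ?w)\<^sup>2)"
    by (simp add: prob_S_Suc_le_explicit mult_ac)
  then show ?thesis
    unfolding renewal_function_eq_suminf emeasure_eq_measure
    by (intro suminf_ennreal_eq) auto
qed

end

end

end

text \<open>Raising the level shrinks the set whose infimum is taken. This carries finiteness from
  positive levels to all real ones.\<close>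

lemma renewal_function_mono:
  assumes "s \<le> t"
  shows "renewal_function M S s \<le> renewal_function M S t"
  unfolding renewal_function_def renewal_process_def
proof (intro nn_integral_mono)
  fix \<omega>
  have "Inf {enat n |n. s < S (Suc n) \<omega>} \<le> Inf {enat n |n. t < S (Suc n) \<omega>}"
    using assms by (intro Inf_superset_mono) auto
  then show "ennreal_of_enat (Inf {enat n |n. s < S (Suc n) \<omega>})
      \<le> ennreal_of_enat (Inf {enat n |n. t < S (Suc n) \<omega>})"
    by simp
qed

section \<open>Asymptotics\<close>

text \<open>Substituting 1/x moves the limit to 0 from the right; the inner derivative -1/x^2
  appears in numerator and denominator and cancels.\<close>

lemma lhospital_0_at_top:
  fixes f g :: "real \<Rightarrow> real"
  assumes lim0: "(f \<longlongrightarrow> 0) at_top" "(g \<longlongrightarrow> 0) at_top"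
    and nz: "\<forall>\<^sub>F x in at_top. g x \<noteq> 0" "\<forall>\<^sub>F x in at_top. g' x \<noteq> 0"
    and D: "\<forall>\<^sub>F x in at_top. DERIV f x :> f' x" "\<forall>\<^sub>F x in at_top. DERIV g x :> g' x"
    and lim: "((\<lambda>x. f' x / g' x) \<longlongrightarrow> l) at_top"
  shows "((\<lambda>x. f x / g x) \<longlongrightarrow> l) at_top"
  unfolding filterlim_at_top_to_right
proof (rule lhopital_right_0)
  let ?D = "\<lambda>f' x. f' (inverse x) * - (inverse x ^ Suc (Suc 0))"
  show "((\<lambda>x. f (inverse x)) \<longlongrightarrow> 0) (at_right 0)" "((\<lambda>x. g (inverse x)) \<longlongrightarrow> 0) (at_right 0)"
    using lim0 unfolding filterlim_at_top_to_right .
  show "\<forall>\<^sub>F x in at_right 0. g (inverse x) \<noteq> 0"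
    unfolding eventually_at_right_to_top using nz(1) by simp
  show "\<forall>\<^sub>F x in at_right 0. ?D g' x \<noteq> 0"
    unfolding eventually_at_right_to_top
    using nz(2) eventually_ge_at_top[of 1] by eventually_elim auto
  show "\<forall>\<^sub>F x in at_right 0. DERIV (\<lambda>x. f (inverse x)) x :> ?D f' x"
    unfolding eventually_at_right_to_top using D(1) eventually_ge_at_top[of 1]
    by eventually_elim (rule derivative_eq_intros DERIV_chain'[where f=inverse] | simp)+
  show "\<forall>\<^sub>F x in at_right 0. DERIV (\<lambda>x. g (inverse x)) x :> ?D g' x"
    unfolding eventually_at_right_to_top using D(2) eventually_ge_at_top[of 1]
    by eventually_elim (rule derivative_eq_intros DERIV_chain'[where f=inverse] | simp)+
  have "((\<lambda>x. ?D f' x / ?D g' x) \<longlongrightarrow> l) (at_right 0)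
    \<longleftrightarrow> ((\<lambda>x. f' (inverse x) / g' (inverse x)) \<longlongrightarrow> l) (at_right 0)"
    by (intro filterlim_cong refl) (auto simp: eventually_at_filter)
  then show "((\<lambda>x. ?D f' x / ?D g' x) \<longlongrightarrow> l) (at_right 0)"
    using lim unfolding filterlim_at_top_to_right by simp
qed

text \<open>Apply the mean value theorem to \<open>R\<close>; applied to \<open>ln \<circ> H\<close> it shows that moving
  the argument of \<open>H\<close> by a bounded amount does not change it asymptotically.\<close>
lemma increment_asymptotics:
  fixes R R' H H' :: "real \<Rightarrow> real"
  assumes DR: "\<forall>\<^sub>F t in at_top. DERIV R t :> R' t"
    and DH: "\<forall>\<^sub>F t in at_top. DERIV H t :> H' t"
    and pos: "\<forall>\<^sub>F t in at_top. 0 < H t"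
    and lim_H: "((\<lambda>t. t * H' t / H t) \<longlongrightarrow> \<theta>) at_top"
    and lim_R: "((\<lambda>t. H t * R' t / t powr p) \<longlongrightarrow> c) at_top"
    and d: "0 < d"
  shows "((\<lambda>t. H t * (R (t + d) - R t) / t powr p) \<longlongrightarrow> c * d) at_top"
proof -
  obtain T where T: "0 < T" "\<And>t. T \<le> t \<Longrightarrow> DERIV R t :> R' t"
    "\<And>t. T \<le> t \<Longrightarrow> DERIV H t :> H' t" "\<And>t. T \<le> t \<Longrightarrow> 0 < H t"
    using eventually_conj[OF eventually_gt_at_top[of 0] eventually_conj[OF DR eventually_conj[OF DH pos]]]
    unfolding eventually_at_top_linorder by (metis order.refl)
  have "\<exists>\<xi>. t < \<xi> \<and> \<xi> < t + d \<and> R (t + d) - R t = (t + d - t) * R' \<xi>" if "T \<le> t" for t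
    using that d by (intro MVT2 T(2)) auto
  then obtain \<xi> where \<xi>: "\<And>t. T \<le> t \<Longrightarrow> t < \<xi> t" "\<And>t. T \<le> t \<Longrightarrow> \<xi> t < t + d"
    "\<And>t. T \<le> t \<Longrightarrow> R (t + d) - R t = d * R' (\<xi> t)"
    by simp metis
  have "\<exists>\<eta>. t < \<eta> \<and> \<eta> < \<xi> t \<and> ln (H (\<xi> t)) - ln (H t) = (\<xi> t - t) * (H' \<eta> / H \<eta>)"
    if "T \<le> t" for t
  proof (intro MVT2 \<xi>(1) that)
    fix x assume "t \<le> x" "x \<le> \<xi> t"
    with that have "T \<le> x" by simp
    with T show "DERIV (\<lambda>x. ln (H x)) x :> H' x / H x"
      by (auto intro!: derivative_eq_intros)
  qed
  then obtain \<eta> where \<eta>: "\<And>t. T \<le> t \<Longrightarrow> t < \<eta> t"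
    "\<And>t. T \<le> t \<Longrightarrow> ln (H (\<xi> t)) - ln (H t) = (\<xi> t - t) * (H' (\<eta> t) / H (\<eta> t))"
    by metis
  have ev: "\<forall>\<^sub>F t in at_top. T \<le> t" by (rule eventually_ge_at_top)
  have \<xi>_top: "filterlim \<xi> at_top at_top"
    by (rule filterlim_at_top_mono[OF filterlim_ident]) (use ev in eventually_elim, simp add: \<xi>(1) less_imp_le)
  have \<eta>_top: "filterlim \<eta> at_top at_top"
    by (rule filterlim_at_top_mono[OF filterlim_ident]) (use ev in eventually_elim, simp add: \<eta>(1) less_imp_le)
  \<comment> \<open>The logarithmic derivative of \<open>H\<close> is \<theta>/t up to o(1/t), so it
    tends to 0, and \<open>ln (H t)\<close> changes by o(1) over a distance of at most
    \<open>d\<close>.\<close>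
  have "((\<lambda>t. t * H' t / H t * inverse t) \<longlongrightarrow> \<theta> * 0) at_top"
    by (intro tendsto_mult lim_H tendsto_inverse_0_at_top filterlim_ident)
  then have "((\<lambda>t. t * H' t / H t * inverse t) \<longlongrightarrow> 0) at_top" by simp
  then have "((\<lambda>t. H' t / H t) \<longlongrightarrow> 0) at_top"
    by (rule Lim_transform_eventually) (use eventually_gt_at_top[of 0] in eventually_elim, simp)
  from filterlim_compose[OF this \<eta>_top]
  have log_deriv: "((\<lambda>t. d * \<bar>H' (\<eta> t) / H (\<eta> t)\<bar>) \<longlongrightarrow> 0) at_top"
    by (intro tendsto_mult_right_zero tendsto_rabs_zero)
  have "((\<lambda>t. ln (H (\<xi> t)) - ln (H t)) \<longlongrightarrow> 0) at_top"
  proof (rule Lim_null_comparison[OF _ log_deriv])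
    show "\<forall>\<^sub>F t in at_top. norm (ln (H (\<xi> t)) - ln (H t)) \<le> d * \<bar>H' (\<eta> t) / H (\<eta> t)\<bar>"
      using ev
    proof eventually_elim
      case (elim t)
      have "\<bar>\<xi> t - t\<bar> \<le> d" using \<xi>(1,2)[OF elim] by simp
      then show ?case unfolding \<eta>(2)[OF elim] real_norm_def abs_mult
        by (rule mult_right_mono) simp
    qed
  qed
  then have "((\<lambda>t. exp (- (ln (H (\<xi> t)) - ln (H t)))) \<longlongrightarrow> exp (- 0)) at_top"
    by (intro tendsto_exp tendsto_minus)
  then have H_ratio: "((\<lambda>t. H t / H (\<xi> t)) \<longlongrightarrow> 1) at_top"
    unfolding minus_zero exp_zero
  proof (rule Lim_transform_eventually)
    show "\<forall>\<^sub>F t in at_top. exp (- (ln (H (\<xi> t)) - ln (H t))) = H t / H (\<xi> t)"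
      using ev
    proof eventually_elim
      case (elim t)
      then have "0 < H t" "0 < H (\<xi> t)" using T(4) \<xi>(1)[OF elim] by auto
      then show ?case by (simp add: exp_diff)
    qed
  qed
  have "((\<lambda>t. 1 + d * inverse t) \<longlongrightarrow> 1 + d * 0) at_top"
    by (intro tendsto_add tendsto_mult tendsto_const tendsto_inverse_0_at_top filterlim_ident)
  then have upper: "((\<lambda>t. 1 + d * inverse t) \<longlongrightarrow> 1) at_top" by simp
  have "((\<lambda>t. \<xi> t / t) \<longlongrightarrow> 1) at_top"
  proof (rule tendsto_sandwich[OF _ _ tendsto_const upper])
    show "\<forall>\<^sub>F t in at_top. 1 \<le> \<xi> t / t"
      using ev by eventually_elim (use \<xi>(1) T(1) in \<open>force simp: field_simps\<close>)
    show "\<forall>\<^sub>F t in at_top. \<xi> t / t \<le> 1 + d * inverse t"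
      using ev
    proof eventually_elim
      case (elim t)
      then show ?case using \<xi>(2)[OF elim] T(1) by (simp add: field_simps)
    qed
  qed
  then have "((\<lambda>t. (\<xi> t / t) powr p) \<longlongrightarrow> 1 powr p) at_top"
    by (intro tendsto_powr tendsto_const) simp_all
  \<comment> \<open>The increment is \<open>d * R' (\<xi> t)\<close>. The known limit is taken at
    \<open>\<xi> t\<close>, and the last two factors, both tending to 1, return the power and
    \<open>H\<close> to the point t.\<close>
  then have "((\<lambda>t. d * (H (\<xi> t) * R' (\<xi> t) / \<xi> t powr p) * (\<xi> t / t) powr p * (H t / H (\<xi> t)))
      \<longlongrightarrow> d * c * 1 powr p * 1) at_top"
    by (intro tendsto_mult tendsto_const H_ratio filterlim_compose[OF lim_R \<xi>_top])
  then have "((\<lambda>t. d * (H (\<xi> t) * R' (\<xi> t) / \<xi> t powr p) * (\<xi> t / t) powr p * (H t / H (\<xi> t)))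
      \<longlongrightarrow> c * d) at_top"
    by (simp add: mult.commute)
  then show ?thesis
  proof (rule Lim_transform_eventually)
    show "\<forall>\<^sub>F t in at_top. d * (H (\<xi> t) * R' (\<xi> t) / \<xi> t powr p) * (\<xi> t / t) powr p * (H t / H (\<xi> t))
        = H t * (R (t + d) - R t) / t powr p"
      using ev
    proof eventually_elim
      case (elim t)
      then have "0 < H (\<xi> t)" "0 < t" "0 < \<xi> t" using T(1,4) \<xi>(1)[OF elim] by auto
      then show ?case by (simp add: \<xi>(3)[OF elim] powr_divide)
    qed
  qed
qed

text \<open>The limit of \<open>h / u\<close> comes from de l'Hospital's rule, because
  \<open>h' / u' = 1 - (t * f t / h t) / \<alpha>\<close>.\<close>
lemma renewal_derivative_asymptotics:
  fixes F H f :: "real \<Rightarrow> real" and \<alpha> \<theta> :: real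
  defines "h \<equiv> \<lambda>t. H t * t powr (- \<alpha>)"
  defines "u \<equiv> \<lambda>t. 1 - F t + h t"
  defines "R \<equiv> \<lambda>t. 1 / u t - 1 + h t / (u t)\<^sup>2"
  defines "R' \<equiv> \<lambda>t. f t / (u t)\<^sup>2 + 2 * \<alpha> * (h t)\<^sup>2 / (t * (u t) ^ 3)"
  assumes \<alpha>: "0 < \<alpha>"
    and DF: "\<And>t. 0 < t \<Longrightarrow> DERIV F t :> f t"
    and DH: "\<And>t. 0 < t \<Longrightarrow> DERIV H t :> t powr \<alpha> * f t"
    and F_le: "\<And>t. F t \<le> 1"
    and F_lim: "(F \<longlongrightarrow> 1) at_top"
    and h_lim: "(h \<longlongrightarrow> 0) at_top"
    and pos: "\<forall>\<^sub>F t in at_top. 0 < H t"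
    and lim: "((\<lambda>t. t * (t powr \<alpha> * f t) / H t) \<longlongrightarrow> \<theta>) at_top"
  shows "\<And>t. 0 < t \<Longrightarrow> 0 < u t \<Longrightarrow> DERIV R t :> R' t"
    and "((\<lambda>t. H t * R' t / t powr (\<alpha> - 1)) \<longlongrightarrow> ((\<alpha> - \<theta>) / \<alpha>)\<^sup>2 * (2 * \<alpha> - \<theta>)) at_top"
proof -
  have Dh: "DERIV h t :> f t - \<alpha> * h t / t" if "0 < t" for t
  proof -
    have "t powr \<alpha> * t powr (- \<alpha>) = 1" using that by (simp add: powr_add[symmetric])
    moreover have "t powr (- \<alpha> - 1) = t powr (- \<alpha>) / t" using that by (simp add: powr_diff)
    ultimately show ?thesis
      unfolding h_def using that
      by (auto intro!: derivative_eq_intros DH has_real_derivative_powr simp: field_simps)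
  qed
  have Du: "DERIV u t :> - \<alpha> * h t / t" if "0 < t" for t
    unfolding u_def using that by (auto intro!: derivative_eq_intros DF Dh)
  show "DERIV R t :> R' t" if "0 < t" "0 < u t" for t
  proof -
    let ?u' = "- \<alpha> * h t / t" and ?h' = "f t - \<alpha> * h t / t"
    have "DERIV (\<lambda>t. inverse (u t) - 1 + h t * (inverse (u t))\<^sup>2) t :>
        - (inverse (u t) * ?u' * inverse (u t)) - 0
        + (?h' * (inverse (u t))\<^sup>2
          + (2 * inverse (u t) * - (inverse (u t) * ?u' * inverse (u t))) * h t)"
      using that
      by (intro DERIV_add DERIV_diff DERIV_const DERIV_mult DERIV_inverse' Du Dh)
        (auto intro!: derivative_eq_intros Du)
    moreover have "R = (\<lambda>t. inverse (u t) - 1 + h t * (inverse (u t))\<^sup>2)"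
      unfolding R_def by (simp add: fun_eq_iff divide_inverse power_inverse)
    \<comment> \<open>The terms \<alpha> h / (t u^2) from the derivatives of 1/u and of h cancel;
      only f / u^2 and the term in h^2 remain.\<close>
    moreover have "R' t = - (inverse (u t) * ?u' * inverse (u t)) - 0
        + (?h' * (inverse (u t))\<^sup>2
          + (2 * inverse (u t) * - (inverse (u t) * ?u' * inverse (u t))) * h t)"
      using that by (simp add: R'_def field_simps power2_eq_square power3_eq_cube)
    ultimately show ?thesis by simp
  qed
  \<comment> \<open>Eventually u >= h > 0, because F <= 1.\<close>
  have ev: "\<forall>\<^sub>F t in at_top. 0 < t \<and> 0 < h t \<and> 0 < u t"
    using pos eventually_gt_at_top[of 0]
  proof eventually_elim
    case (elim t)
    then have "0 < h t" by (simp add: h_def)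
    then show ?case using F_le[of t] elim by (simp add: u_def)
  qed
  have quot: "t * (t powr \<alpha> * f t) / H t = t * f t / h t" if "0 < t" "0 < h t" for t
    using that by (simp add: h_def powr_minus field_simps)
  have lim_h: "((\<lambda>t. t * f t / h t) \<longlongrightarrow> \<theta>) at_top"
    using lim by (rule Lim_transform_eventually) (use ev in eventually_elim, simp add: quot)
  have q: "((\<lambda>t. h t / u t) \<longlongrightarrow> (\<alpha> - \<theta>) / \<alpha>) at_top"
  proof (rule lhospital_0_at_top[OF h_lim])
    have "((\<lambda>t. 1 - F t + h t) \<longlongrightarrow> 1 - 1 + 0) at_top"
      by (intro tendsto_intros F_lim h_lim)
    then show "(u \<longlongrightarrow> 0) at_top" by (simp add: u_def)
    show "\<forall>\<^sub>F t in at_top. u t \<noteq> 0" using ev by eventually_elim simp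
    show "\<forall>\<^sub>F t in at_top. - \<alpha> * h t / t \<noteq> 0" using ev by eventually_elim (use \<alpha> in simp)
    show "\<forall>\<^sub>F t in at_top. DERIV h t :> f t - \<alpha> * h t / t"
      using eventually_gt_at_top[of 0] by eventually_elim (rule Dh)
    show "\<forall>\<^sub>F t in at_top. DERIV u t :> - \<alpha> * h t / t"
      using eventually_gt_at_top[of 0] by eventually_elim (rule Du)
    have "((\<lambda>t. 1 - t * f t / h t / \<alpha>) \<longlongrightarrow> 1 - \<theta> / \<alpha>) at_top"
      using \<alpha> by (intro tendsto_intros lim_h) simp
    then have "((\<lambda>t. 1 - t * f t / h t / \<alpha>) \<longlongrightarrow> (\<alpha> - \<theta>) / \<alpha>) at_top"
      using \<alpha> by (simp add: diff_divide_distrib)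
    then show "((\<lambda>t. (f t - \<alpha> * h t / t) / (- \<alpha> * h t / t)) \<longlongrightarrow> (\<alpha> - \<theta>) / \<alpha>) at_top"
      by (rule Lim_transform_eventually) (use ev in eventually_elim, use \<alpha> in \<open>simp add: field_simps\<close>)
  qed
  \<comment> \<open>The quantity in question equals t h R', which expands to this expression. With q
    = (\<alpha> - \<theta>)/\<alpha> its limit is q^2 (\<theta> + 2\<alpha> q) = q^2 (2\<alpha> -
    \<theta>).\<close>
  have "((\<lambda>t. t * f t / h t * (h t / u t)\<^sup>2 + 2 * \<alpha> * (h t / u t) ^ 3)
      \<longlongrightarrow> \<theta> * ((\<alpha> - \<theta>) / \<alpha>)\<^sup>2 + 2 * \<alpha> * ((\<alpha> - \<theta>) / \<alpha>) ^ 3) at_top"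
    by (intro tendsto_intros lim_h q)
  also have "\<theta> * ((\<alpha> - \<theta>) / \<alpha>)\<^sup>2 + 2 * \<alpha> * ((\<alpha> - \<theta>) / \<alpha>) ^ 3
      = ((\<alpha> - \<theta>) / \<alpha>)\<^sup>2 * (2 * \<alpha> - \<theta>)"
    using \<alpha> by (simp add: power2_eq_square power3_eq_cube field_simps)
  finally show "((\<lambda>t. H t * R' t / t powr (\<alpha> - 1))
      \<longlongrightarrow> ((\<alpha> - \<theta>) / \<alpha>)\<^sup>2 * (2 * \<alpha> - \<theta>)) at_top"
  proof (rule Lim_transform_eventually)
    show "\<forall>\<^sub>F t in at_top. t * f t / h t * (h t / u t)\<^sup>2 + 2 * \<alpha> * (h t / u t) ^ 3
        = H t * R' t / t powr (\<alpha> - 1)"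
      using ev
    proof eventually_elim
      case (elim t)
      then have "H t / t powr (\<alpha> - 1) = t * h t"
        by (simp add: h_def powr_minus powr_diff field_simps)
      then have "H t * R' t / t powr (\<alpha> - 1) = t * h t * R' t"
        by (metis times_divide_eq_left)
      also have "\<dots> = t * f t / h t * (h t / u t)\<^sup>2 + 2 * \<alpha> * (h t / u t) ^ 3"
        using elim by (simp add: R'_def field_simps power2_eq_square power3_eq_cube)
      finally show ?case ..
    qed
  qed
qed

section \<open>Limit and derivative of the truncated moment\<close>

lemma truncated_moment_eq_scaled_moment:
  assumes "0 < t"
  shows "truncated_moment \<alpha> \<nu> t = t powr \<alpha> * scaled_moment \<alpha> \<nu> t"
proof -
  have "indicator {0..t} x * x powr \<alpha> = t powr \<alpha> * moment_kernel \<alpha> t x" for x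
    using assms by (simp add: moment_kernel_def powr_divide indicator_def)
  then show ?thesis
    by (simp add: truncated_moment_def scaled_moment_def set_lebesgue_integral_def)
qed

text \<open>Dominated convergence with the constant bound 1: for fixed x the kernel is eventually
  (x/t)^\<alpha>, which tends to 0.\<close>

lemma scaled_moment_tendsto_0:
  assumes "0 < \<alpha>" "\<nu> \<in> P_plus"
  shows "((\<lambda>t. scaled_moment \<alpha> \<nu> t) \<longlongrightarrow> 0) at_top"
proof -
  interpret real_distribution \<nu> using P_plusD[OF assms(2)] by simp
  have "((\<lambda>t. LINT x|\<nu>. moment_kernel \<alpha> t x) \<longlongrightarrow> (LINT x|\<nu>. 0)) at_top"
  proof (rule integral_dominated_convergence_at_top[where w="\<lambda>_. 1"])
    show "AE x in \<nu>. ((\<lambda>t. moment_kernel \<alpha> t x) \<longlongrightarrow> 0) at_top"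
      using P_plusD(2)[OF assms(2)]
    proof eventually_elim
      case (elim x)
      have "((\<lambda>t. x * inverse t) \<longlongrightarrow> x * 0) at_top"
        by (intro tendsto_mult tendsto_const tendsto_inverse_0_at_top filterlim_ident)
      then have "((\<lambda>t. (x * inverse t) powr \<alpha>) \<longlongrightarrow> 0 powr \<alpha>) at_top"
        using elim assms
        by (intro tendsto_powr2 tendsto_const)
          (auto intro: eventually_mono[OF eventually_gt_at_top[of 0]])
      then have "((\<lambda>t. (x * inverse t) powr \<alpha>) \<longlongrightarrow> 0) at_top" by simp
      then show ?case
      proof (rule Lim_transform_eventually)
        show "\<forall>\<^sub>F t in at_top. (x * inverse t) powr \<alpha> = moment_kernel \<alpha> t x"
          using eventually_ge_at_top[of x]
          by eventually_elim (use elim in \<open>simp add: moment_kernel_def divide_inverse\<close>)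
      qed
    qed
    show "\<forall>\<^sub>F t in at_top. AE x in \<nu>. norm (moment_kernel \<alpha> t x) \<le> 1"
      using eventually_gt_at_top[of 0]
      by eventually_elim (use assms moment_kernel_le_one in simp)
  qed auto
  then show ?thesis by (simp add: scaled_moment_def)
qed

text \<open>On (a, b] the integrand x^\<alpha> lies between a^\<alpha> and b^\<alpha>. The bounds
  tie H to F without the density, so that H can be differentiated wherever F can, even where f is
  discontinuous.\<close>

lemma truncated_moment_increment_bounds:
  assumes "0 < \<alpha>" "real_distribution \<nu>" "0 \<le> a" "a < b"
  shows "a powr \<alpha> * (cdf \<nu> b - cdf \<nu> a) \<le> truncated_moment \<alpha> \<nu> b - truncated_moment \<alpha> \<nu> a"
    and "truncated_moment \<alpha> \<nu> b - truncated_moment \<alpha> \<nu> a \<le> b powr \<alpha> * (cdf \<nu> b - cdf \<nu> a)"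
proof -
  interpret real_distribution \<nu> by fact
  have int: "integrable \<nu> (\<lambda>x. indicator {0..s} x * x powr \<alpha>)" for s
    using assms(1)
    by (intro integrable_const_bound[where B="s powr \<alpha>"])
      (auto simp: indicator_def intro!: powr_mono2)
  have "truncated_moment \<alpha> \<nu> b - truncated_moment \<alpha> \<nu> a
      = (LINT x|\<nu>. indicator {0..b} x * x powr \<alpha> - indicator {0..a} x * x powr \<alpha>)"
    by (simp add: truncated_moment_def set_lebesgue_integral_def int)
  also have "\<dots> = (LINT x|\<nu>. indicator {a<..b} x * x powr \<alpha>)"
    using assms by (intro Bochner_Integration.integral_cong) (auto simp: indicator_def)
  finally have eq: "truncated_moment \<alpha> \<nu> b - truncated_moment \<alpha> \<nu> a
      = (LINT x|\<nu>. indicator {a<..b} x * x powr \<alpha>)" .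
  have F: "cdf \<nu> b - cdf \<nu> a = (LINT x|\<nu>. indicator {a<..b} x)"
    using assms by (simp add: cdf_diff_eq)
  have int': "integrable \<nu> (\<lambda>x. indicator {a<..b} x * x powr \<alpha>)"
    using assms
    by (intro integrable_const_bound[where B="b powr \<alpha>"])
      (auto simp: indicator_def intro!: powr_mono2)
  have int_ind: "integrable \<nu> (indicator {a<..b} :: real \<Rightarrow> real)"
    by (simp add: emeasure_eq_measure)
  show "a powr \<alpha> * (cdf \<nu> b - cdf \<nu> a) \<le> truncated_moment \<alpha> \<nu> b - truncated_moment \<alpha> \<nu> a"
    unfolding eq F integral_mult_right_zero[symmetric]
    using assms
    by (intro integral_mono integrable_mult_right int' int_ind)
      (auto simp: indicator_def intro!: powr_mono2)
  show "truncated_moment \<alpha> \<nu> b - truncated_moment \<alpha> \<nu> a \<le> b powr \<alpha> * (cdf \<nu> b - cdf \<nu> a)"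
    unfolding eq F integral_mult_right_zero[symmetric]
    using assms
    by (intro integral_mono integrable_mult_right int' int_ind)
      (auto simp: indicator_def intro!: powr_mono2)
qed

text \<open>The difference quotients are compared through
  \<open>\<bar>H s - H t - t powr \<alpha> * (F s - F t)\<bar> \<le> \<bar>s powr \<alpha> - t powr \<alpha>\<bar> * \<bar>F s - F t\<bar>\<close>.\<close>
lemma DERIV_truncated_moment:
  assumes "0 < \<alpha>" "real_distribution \<nu>" "0 < t" and DF: "DERIV (cdf \<nu>) t :> l"
  shows "DERIV (truncated_moment \<alpha> \<nu>) t :> t powr \<alpha> * l"
proof -
  let ?H = "truncated_moment \<alpha> \<nu>" and ?F = "cdf \<nu>"
  have bound: "\<bar>?H s - ?H t - t powr \<alpha> * (?F s - ?F t)\<bar> \<le> \<bar>s powr \<alpha> - t powr \<alpha>\<bar> * \<bar>?F s - ?F t\<bar>"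
    if "0 < s" for s
  proof (cases s t rule: linorder_cases)
    case less
    interpret real_distribution \<nu> by fact
    have "?F s \<le> ?F t" "s powr \<alpha> \<le> t powr \<alpha>"
      using less that assms by (auto intro: cdf_nondecreasing powr_mono2)
    moreover have "s powr \<alpha> * (?F t - ?F s) \<le> ?H t - ?H s" "?H t - ?H s \<le> t powr \<alpha> * (?F t - ?F s)"
      using truncated_moment_increment_bounds[OF assms(1,2) _ less] that by auto
    moreover from calculation
    have "\<bar>s powr \<alpha> - t powr \<alpha>\<bar> * \<bar>?F s - ?F t\<bar> = (t powr \<alpha> - s powr \<alpha>) * (?F t - ?F s)"
      by (simp add: abs_of_nonpos algebra_simps)
    ultimately show ?thesis by (simp add: abs_le_iff algebra_simps)
  next
    case greater
    interpret real_distribution \<nu> by fact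
    have "?F t \<le> ?F s" "t powr \<alpha> \<le> s powr \<alpha>"
      using greater that assms by (auto intro: cdf_nondecreasing powr_mono2)
    moreover have "t powr \<alpha> * (?F s - ?F t) \<le> ?H s - ?H t" "?H s - ?H t \<le> s powr \<alpha> * (?F s - ?F t)"
      using truncated_moment_increment_bounds[OF assms(1,2) _ greater] assms by auto
    moreover from calculation
    have "\<bar>s powr \<alpha> - t powr \<alpha>\<bar> * \<bar>?F s - ?F t\<bar> = (s powr \<alpha> - t powr \<alpha>) * (?F s - ?F t)"
      by (simp add: abs_of_nonneg algebra_simps)
    ultimately show ?thesis by (simp add: abs_le_iff algebra_simps)
  qed simp
  have quot: "((\<lambda>s. (?F s - ?F t) / (s - t)) \<longlongrightarrow> l) (at t)"
    using DF by (simp add: has_field_derivative_iff)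
  \<comment> \<open>A convergent difference quotient times a factor that vanishes as s tends to t:
    this bounds the error after division by s - t.\<close>
  have "((\<lambda>s. \<bar>s powr \<alpha> - t powr \<alpha>\<bar> * \<bar>(?F s - ?F t) / (s - t)\<bar>) \<longlongrightarrow> \<bar>t powr \<alpha> - t powr \<alpha>\<bar> * \<bar>l\<bar>) (at t)"
    using assms(3) by (intro tendsto_intros quot) auto
  then have "((\<lambda>s. \<bar>s powr \<alpha> - t powr \<alpha>\<bar> * \<bar>(?F s - ?F t) / (s - t)\<bar>) \<longlongrightarrow> 0) (at t)" by simp
  then have "((\<lambda>s. (?H s - ?H t - t powr \<alpha> * (?F s - ?F t)) / (s - t)) \<longlongrightarrow> 0) (at t)"
  proof (rule Lim_null_comparison[rotated])
    have "\<forall>\<^sub>F s in at t. 0 < s"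
      using assms(3) by (intro order_tendstoD(1)[OF tendsto_ident_at])
    then show "\<forall>\<^sub>F s in at t. norm ((?H s - ?H t - t powr \<alpha> * (?F s - ?F t)) / (s - t))
        \<le> \<bar>s powr \<alpha> - t powr \<alpha>\<bar> * \<bar>(?F s - ?F t) / (s - t)\<bar>"
      by eventually_elim (use bound in \<open>simp add: divide_right_mono\<close>)
  qed
  then have "((\<lambda>s. (?H s - ?H t - t powr \<alpha> * (?F s - ?F t)) / (s - t)
      + t powr \<alpha> * ((?F s - ?F t) / (s - t))) \<longlongrightarrow> 0 + t powr \<alpha> * l) (at t)"
    by (intro tendsto_intros quot)
  then show ?thesis
    by (simp add: has_field_derivative_iff add_divide_distrib[symmetric])
qed

section \<open>Nondegeneracy of a law without an atom at 0\<close>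

context
  fixes \<nu> :: "real measure" and \<alpha> t :: real
  assumes alpha: "0 < \<alpha>" and nu: "\<nu> \<in> P_plus" and no_atom: "AE x in \<nu>. x \<noteq> 0" and t: "0 < t"
begin

interpretation real_distribution \<nu> using P_plusD[OF nu] by simp

text \<open>The kernel is at most 1, with equality only at x = 0; a transform equal to 1 would
  therefore put all mass at 0.\<close>

lemma williamson_less_1: "williamson \<alpha> \<nu> t < 1"
proof (rule ccontr)
  assume "\<not> williamson \<alpha> \<nu> t < 1"
  moreover have int: "integrable \<nu> (\<lambda>x. 1 - williamson_kernel \<alpha> t x)"
    by (intro Bochner_Integration.integrable_diff integrable_williamson_kernel alpha t nu) simp
  moreover have "(LINT x|\<nu>. 1 - williamson_kernel \<alpha> t x) = 1 - williamson \<alpha> \<nu> t"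
    using prob_space
    by (simp add: williamson_def integrable_williamson_kernel alpha t nu)
  moreover have nn: "0 \<le> (LINT x|\<nu>. 1 - williamson_kernel \<alpha> t x)"
    by (intro integral_nonneg_AE) (simp add: williamson_kernel_le_one)
  ultimately have "(LINT x|\<nu>. 1 - williamson_kernel \<alpha> t x) = 0" by simp
  then have "AE x in \<nu>. 1 - williamson_kernel \<alpha> t x = 0"
    using integral_nonneg_eq_0_iff_AE[OF int] by (simp add: williamson_kernel_le_one)
  then have "AE x in \<nu>. False"
    using no_atom
    by eventually_elim
      (use t in \<open>auto simp: williamson_kernel_def indicator_def of_bool_def split: if_splits\<close>)
  then show False by simp
qed

text \<open>The moment kernel is positive on (0, t], so a vanishing moment would leave no mass up to
  t.\<close>

lemma truncated_moment_pos:
  assumes "0 < cdf \<nu> t"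
  shows "0 < truncated_moment \<alpha> \<nu> t"
proof (rule ccontr)
  assume "\<not> 0 < truncated_moment \<alpha> \<nu> t"
  then have "scaled_moment \<alpha> \<nu> t = 0"
    using t scaled_moment_nonneg[of \<alpha> \<nu> t]
    by (simp add: truncated_moment_eq_scaled_moment zero_less_mult_iff)
  then have "AE x in \<nu>. moment_kernel \<alpha> t x = 0"
    using integral_nonneg_eq_0_iff_AE[OF integrable_moment_kernel[OF alpha t nu]]
    by (simp add: scaled_moment_def)
  then have "AE x in \<nu>. x \<notin> {..t}"
    using no_atom P_plusD(2)[OF nu]
    by eventually_elim (use t in \<open>auto simp: moment_kernel_def indicator_def split: if_splits\<close>)
  then have "prob {..t} = 0" by (simp add: prob_eq_0)
  then show False using assms by (simp add: cdf_def)
qed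

end

text \<open>\<open>enn2real\<close> sends \<infinity> to 0 and \<open>deriv\<close> is informative
  only for differentiable functions, so finiteness and eventual differentiability belong to the
  conclusion. In the hypothesis, \<open>deriv H\<close> at t > 0 is t^\<alpha> f(t) by
  \<open>DERIV_truncated_moment\<close>.\<close>

theorem theorem4:
  fixes M :: "'a measure" and S :: "nat \<Rightarrow> 'a \<Rightarrow> real"
    and \<nu> :: "real measure" and f :: "real \<Rightarrow> real" and \<alpha> \<theta> :: real
  defines "H \<equiv> truncated_moment \<alpha> \<nu>"
    and "R \<equiv> \<lambda>t. enn2real (renewal_function M S t)"
    and "c \<equiv> ((\<alpha> - \<theta>) / \<alpha>)\<^sup>2 * (2 * \<alpha> - \<theta>)"
  assumes "0 < \<alpha>"
    and "\<nu> \<in> P_plus"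
    and "kendall_random_walk M S \<alpha> \<nu>"
    and "\<And>t. 0 < t \<Longrightarrow> (cdf \<nu> has_real_derivative f t) (at t)"
    and "f \<in> borel_measurable borel"
    and "\<nu> = density lborel (\<lambda>x. ennreal (f x))"
    and "0 \<le> \<theta>" and "\<theta> < \<alpha>"
    and "((\<lambda>t. t * deriv H t / H t) \<longlongrightarrow> \<theta>) at_top"
  shows "(\<forall>t. renewal_function M S t < \<infinity>)
    \<and> (\<forall>\<^sub>F t in at_top. R differentiable (at t))
    \<and> ((\<lambda>t. H t * deriv R t / t powr (\<alpha> - 1)) \<longlongrightarrow> c) at_top
    \<and> (\<forall>h>0. ((\<lambda>t. H t * (R (t + h) - R t) / t powr (\<alpha> - 1)) \<longlongrightarrow> c * h) at_top)"
proof -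
  note alpha = \<open>0 < \<alpha>\<close> and nu = \<open>\<nu> \<in> P_plus\<close>
  interpret W: kendall_random_walk M S \<alpha> \<nu> by fact
  interpret N: real_distribution \<nu> using P_plusD[OF nu] by simp
  have no_atom: "AE x in \<nu>. x \<noteq> 0"
  proof -
    have "AE x in lborel. x \<noteq> (0::real)" by (rule AE_lborel_singleton)
    then show ?thesis
      unfolding \<open>\<nu> = _\<close> using \<open>f \<in> _\<close> by (subst AE_density) auto
  qed
  \<comment> \<open>These copy the local abbreviations of
    \<open>renewal_derivative_asymptotics\<close>, so that its conclusions can be folded into
    them.\<close>
  define h where "h t = H t * t powr (- \<alpha>)" for t
  define u where "u t = 1 - cdf \<nu> t + h t" for t
  define R' where "R' t = f t / (u t)\<^sup>2 + 2 * \<alpha> * (h t)\<^sup>2 / (t * (u t) ^ 3)" for t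
  have h: "h t = scaled_moment \<alpha> \<nu> t" if "0 < t" for t
    using that by (simp add: h_def H_def truncated_moment_eq_scaled_moment powr_minus field_simps)
  have u: "williamson \<alpha> \<nu> t = 1 - u t" if "0 < t" for t
    using cdf_eq_williamson_plus_scaled_moment[OF alpha that nu] by (simp add: u_def h that)
  have u_pos: "0 < u t" if "0 < t" for t
    using williamson_less_1[OF alpha nu no_atom that] by (simp add: u that)
  have renewal: "renewal_function M S t = ennreal ((1 - u t) / u t + h t / (u t)\<^sup>2)" if "0 < t" for t
    using W.renewal_function_eq[OF alpha nu that williamson_less_1[OF alpha nu no_atom that]]
    by (simp add: u h that)
  have R: "R t = 1 / u t - 1 + h t / (u t)\<^sup>2" if "0 < t" for t
  proof -
    \<comment> \<open>Nonnegativity lets \<open>enn2real\<close> undo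
      \<open>ennreal\<close>.\<close>
    have "0 \<le> (1 - u t) / u t + h t / (u t)\<^sup>2"
      using williamson_nonneg[OF alpha that nu] u_pos[OF that] by (simp add: u h that)
    then show ?thesis
      using u_pos[OF that] by (simp add: R_def renewal that diff_divide_distrib)
  qed
  have DH: "DERIV H t :> t powr \<alpha> * f t" if "0 < t" for t
    unfolding H_def using that alpha assms(7) N.real_distribution_axioms
    by (intro DERIV_truncated_moment) auto
  have F_lim: "(cdf \<nu> \<longlongrightarrow> 1) at_top" by (rule N.cdf_lim_at_top_prob)
  have H_pos: "\<forall>\<^sub>F t in at_top. 0 < H t"
    using order_tendstoD(1)[OF F_lim zero_less_one] eventually_gt_at_top[of 0]
    unfolding H_def by eventually_elim (auto intro: truncated_moment_pos alpha nu no_atom)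
  have h_lim: "(h \<longlongrightarrow> 0) at_top"
    by (rule Lim_transform_eventually[OF scaled_moment_tendsto_0[OF alpha nu]])
      (use eventually_gt_at_top[of 0] in eventually_elim, simp add: h)
  have lim: "((\<lambda>t. t * (t powr \<alpha> * f t) / H t) \<longlongrightarrow> \<theta>) at_top"
    by (rule Lim_transform_eventually[OF assms(12)])
      (use eventually_gt_at_top[of 0] in eventually_elim, simp add: DERIV_imp_deriv[OF DH])
  note asymp = renewal_derivative_asymptotics[of \<alpha> "cdf \<nu>" f H \<theta>, folded h_def, folded u_def,
      folded R'_def c_def, OF alpha assms(7) DH N.cdf_bounded_prob F_lim h_lim H_pos lim]
  have DR: "DERIV R t :> R' t" if "0 < t" for t
  \<comment> \<open>The closed form of \<open>R\<close> is available only on the open half-line,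
    which contains a neighbourhood of t.\<close>
  proof (rule has_field_derivative_transform_within_open)
    show "DERIV (\<lambda>t. 1 / u t - 1 + h t / (u t)\<^sup>2) t :> R' t"
      using that by (intro asymp(1) u_pos)
    show "t \<in> {0<..}" using that by simp
  qed (auto simp: R)
  have R_lim: "((\<lambda>t. H t * R' t / t powr (\<alpha> - 1)) \<longlongrightarrow> c) at_top"
    by (rule asymp(2))
  \<comment> \<open>The closed form needs a positive level, so t is first raised to
    \<open>max t 1\<close>.\<close>
  have "renewal_function M S t < \<infinity>" for t
    using renewal_function_mono[of t "max t 1" M S] renewal[of "max t 1"]
    by (auto simp: le_less_trans)
  moreover have "\<forall>\<^sub>F t in at_top. R differentiable (at t)"
    using eventually_gt_at_top[of 0]
    by eventually_elim (use DR real_differentiable_def in blast)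
  moreover have "((\<lambda>t. H t * deriv R t / t powr (\<alpha> - 1)) \<longlongrightarrow> c) at_top"
    by (rule Lim_transform_eventually[OF R_lim])
      (use eventually_gt_at_top[of 0] in eventually_elim, simp add: DERIV_imp_deriv[OF DR])
  moreover have "((\<lambda>t. H t * (R (t + d) - R t) / t powr (\<alpha> - 1)) \<longlongrightarrow> c * d) at_top"
    if "0 < d" for d
    by (rule increment_asymptotics[OF _ _ H_pos lim R_lim that])
      (use eventually_gt_at_top[of 0] in \<open>eventually_elim, simp add: DR DH\<close>)+
  ultimately show ?thesis by blast
qed

end
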